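(* Let $k>0$ be a fixed integer and let $\alpha_1,\ldots,\alpha_k,\beta_1,\ldots,\beta_k,\gamma_1,\ldots,\gamma_k,\delta_1,\ldots,\delta_k$ be fixed real numbers. For any graph $G$ of order $n\ge k$, let $$F(G)=\sum_{i=1}^{k}\left(\alpha_i\mu_i(G)+\beta_i\mu_{n-i+1}(G)+\gamma_i\mu_i(\overline{G})+\delta_i\mu_{n-i+1}(\overline{G})\right).$$ Let $\mathcal{F}$ be a nonempty multiplicative graph property. Then the limit $$c=\lim_{n\to\infty}\frac1n\max\{F(G): G\in\mathcal{F},\ v(G)=n\}$$ exists (as a real number). Moreover, $$c=\limsup\left\{\frac{1}{|G|}F(G): G\in\mathcal{F}\right\},$$ where the $\limsup$ is taken as the order $|G|\to\infty$.
   Context: Graphs are finite, simple and undirected; a graph of order $n$ has vertex set $[n]=\{1,\ldots,n\}$ (up to isomorphism); $v(G)=|G|$ denotes the order (number of vertices) of $G$, and $\overline{G}$ the complement of $G$. For a graph $G$ of order $n$, $\mu_1(G)\ge\cdots\ge\mu_n(G)$ are the eigenvalues of its adjacency matrix, listed with multiplicity. For a graph $G=(V,E)$ and an integer $t\ge1$, $G^{(t)}$ is the graph obtained by replacing each vertex $u\in V$ by a set $V_u$ of $t$ independent (pairwise non-adjacent) vertices and joining $x\in V_u$ to $y\in V_v$ if and only if $uv\in E$. A graph property is a family of graphs closed under isomorphism. A graph property $\mathcal{F}$ is called multiplicative if: (a) $\mathcal{F}$ is closed under adding isolated vertices; and (b) $G\in\mathcal{F}$ implies $G^{(t)}\in\mathcal{F}$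 for every $t\ge1$. *)

theory Defs
  imports
    "HOL-Library.Extended_Real"
    "HOL-Library.Going_To_Filter"
    "Graph_Theory.Graph_Theory"
    "Jordan_Normal_Form.Char_Poly"
begin

text \<open>
  A finite simple undirected graph is a \<^locale>\<open>pair_graph\<close>: a finite loop-free digraph without
  parallel arcs whose arc relation is symmetric. Graphs of order n carry the vertex set [n].
\<close>

definition gorder :: "'a pair_pre_digraph \<Rightarrow> nat" where
  "gorder G = card (pverts G)"

definition labelled_graphs :: "nat pair_pre_digraph set" where
  "labelled_graphs = {G. pair_graph G \<and> pverts G = {1..gorder G}}"

definition graph_complement :: "'a pair_pre_digraph \<Rightarrow> 'a pair_pre_digraph" where
  "graph_complement G =
    \<lparr>pverts = pverts G,
     parcs = {(u, v). u \<in> pverts G \<and> v \<in> pverts G \<and> u \<noteq> v \<and> (u, v) \<notin> parcs G}\<rparr>"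

definition adjacency_matrix :: "nat pair_pre_digraph \<Rightarrow> real mat" where
  \<comment> \<open>matrix indices start at 0, vertices at 1\<close>
  "adjacency_matrix G =
    mat (gorder G) (gorder G) (\<lambda>(i, j). if (Suc i, Suc j) \<in> parcs G then 1 else 0)"

definition eigenvalue_list :: "nat pair_pre_digraph \<Rightarrow> real list" where
  \<comment> \<open>non-increasing, with multiplicity; it has length equal to the order of G since a real symmetric matrix has
    only real eigenvalues\<close>
  "eigenvalue_list G = rev (sorted_list_of_multiset (proots (char_poly (adjacency_matrix G))))"

definition mu :: "nat \<Rightarrow> nat pair_pre_digraph \<Rightarrow> real" where
  \<comment> \<open>meaningful for i between 1 and the order of G\<close>
  "mu i G = eigenvalue_list G ! (i - 1)"

definition spectral_sum ::
  "nat \<Rightarrow> (nat \<Rightarrow> real) \<Rightarrow> (nat \<Rightarrow> real) \<Rightarrow> (nat \<Rightarrow> real) \<Rightarrow> (nat \<Rightarrow> real) \<Rightarrow>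
    nat pair_pre_digraph \<Rightarrow> real" where
  \<comment> \<open>meaningful for graphs of order at least k\<close>
  "spectral_sum k \<alpha> \<beta> \<gamma> \<delta> G =
    (\<Sum>i = 1..k. \<alpha> i * mu i G + \<beta> i * mu (gorder G - i + 1) G
      + \<gamma> i * mu i (graph_complement G) + \<delta> i * mu (gorder G - i + 1) (graph_complement G))"

definition blow_up :: "nat \<Rightarrow> 'a pair_pre_digraph \<Rightarrow> ('a \<times> nat) pair_pre_digraph" where
  "blow_up t G =
    \<lparr>pverts = pverts G \<times> {1..t},
     parcs = {((u, i), (v, j)). (u, v) \<in> parcs G \<and> i \<in> {1..t} \<and> j \<in> {1..t}}\<rparr>"

definition add_isolated :: "nat \<Rightarrow> nat pair_pre_digraph \<Rightarrow> nat pair_pre_digraph" where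
  "add_isolated s G = \<lparr>pverts = {1..gorder G + s}, parcs = parcs G\<rparr>"

definition graph_property :: "nat pair_pre_digraph set \<Rightarrow> bool" where
  "graph_property \<F> \<longleftrightarrow> \<F> \<subseteq> labelled_graphs \<and>
    (\<forall>G \<in> \<F>. \<forall>H \<in> labelled_graphs. digraph_iso (with_proj G) (with_proj H) \<longrightarrow> H \<in> \<F>)"

text \<open>
  The vertices of a blow-up are pairs, so membership is expressed through the relabellings of the
  blow-up with vertex set [n].
\<close>

definition multiplicative :: "nat pair_pre_digraph set \<Rightarrow> bool" where
  "multiplicative \<F> \<longleftrightarrow> graph_property \<F> \<and>
    (\<forall>G \<in> \<F>. \<forall>s. add_isolated s G \<in> \<F>) \<and>
    (\<forall>G \<in> \<F>. \<forall>t \<ge> 1. \<forall>H \<in> labelled_graphs.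
      digraph_iso (with_proj (blow_up t G)) (with_proj H) \<longrightarrow> H \<in> \<F>)"

text \<open>
  The maxima over all members of a given order are eventually maxima of finite nonempty sets.
\<close>

lemma finite_labelled_graphs_of_order: "finite {G \<in> labelled_graphs. gorder G = n}"
proof -
  have "{G \<in> labelled_graphs. gorder G = n}
      \<subseteq> (\<lambda>(V, E). \<lparr>pverts = V, parcs = E\<rparr>) ` ({{1..n}} \<times> Pow ({1..n} \<times> {1..n}))"
  proof
    fix G assume "G \<in> {G \<in> labelled_graphs. gorder G = n}"
    then have G: "pair_graph G" "pverts G = {1..n}"
      by (auto simp: labelled_graphs_def)
    interpret pair_graph G by (fact G(1))
    have "parcs G \<subseteq> {1..n} \<times> {1..n}"
      using in_arcsD1 in_arcsD2 G(2) by auto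
    then show "G \<in> (\<lambda>(V, E). \<lparr>pverts = V, parcs = E\<rparr>) ` ({{1..n}} \<times> Pow ({1..n} \<times> {1..n}))"
      using G(2) by (intro image_eqI[of _ _ "(pverts G, parcs G)"]) auto
  qed
  then show ?thesis
    by (rule finite_subset) auto
qed

lemma eventually_members_of_order:
  assumes "multiplicative \<F>" "\<F> \<noteq> {}"
  shows "eventually (\<lambda>n. finite {G \<in> \<F>. gorder G = n} \<and> {G \<in> \<F>. gorder G = n} \<noteq> {}) sequentially"
proof -
  from assms(2) obtain G where G: "G \<in> \<F>" by blast
  have "finite {G \<in> \<F>. gorder G = n}" for n
  proof (rule finite_subset[OF _ finite_labelled_graphs_of_order[of n]])
    show "{G \<in> \<F>. gorder G = n} \<subseteq> {G \<in> labelled_graphs. gorder G = n}"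
      using assms(1) unfolding multiplicative_def graph_property_def by blast
  qed
  moreover have "{H \<in> \<F>. gorder H = n} \<noteq> {}" if "n \<ge> gorder G" for n
  proof -
    have "add_isolated (n - gorder G) G \<in> \<F>"
      using assms(1) G by (auto simp: multiplicative_def)
    moreover have "gorder (add_isolated (n - gorder G) G) = n"
      using that by (simp add: gorder_def add_isolated_def)
    ultimately show ?thesis by blast
  qed
  ultimately show ?thesis
    unfolding eventually_sequentially by blast
qed

end

theory Submission
  imports Defs "HOL-Analysis.Function_Topology" "HOL-Analysis.Convex"
begin

text \<open>
  Take a member G of large order n whose normalised value nearly attains the upper limit, and any N
  much larger than n, say N = n t + s with s < n. The blow-up of G by t with s isolated vertices added
  is again a member. Up to entries supported on the n diagonal blocks and on the s extra
  rows and columns, its adjacency matrix and that of its complement are the blow-ups by t of the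
  matrices of G and of its complement; the error has Frobenius norm at most N sqrt (1/n + 2n/N). By the
  Courant-Fischer principle each leading eigenvalue x of such a matrix turns into one between
  t x and t max(x, 0), up to that norm. The leading eigenvalues cannot be very negative, because the
  squares of all eigenvalues sum to at most n squared. Hence the normalised value changes by little, and
  the normalised maxima at all large orders N are nearly as large as the upper limit. The smallest eigenvalues
  of a matrix are handled as the largest ones of its negative.
\<close>

section \<open>Vectors and matrices as functions on index sets\<close>

definition dotp :: "nat \<Rightarrow> (nat \<Rightarrow> real) \<Rightarrow> (nat \<Rightarrow> real) \<Rightarrow> real" where
  "dotp n x y = (\<Sum>i<n. x i * y i)"

text \<open>Only the number of columns is a parameter. The row index stays free, so the same
  function also applies rectangular matrices such as \<open>block_lift\<close>.\<close>

definition matvec :: "nat \<Rightarrow> (nat \<Rightarrow> nat \<Rightarrow> real) \<Rightarrow> (nat \<Rightarrow> real) \<Rightarrow> nat \<Rightarrow> real" where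
  "matvec n M x a = (\<Sum>b<n. M a b * x b)"

definition qform :: "nat \<Rightarrow> (nat \<Rightarrow> nat \<Rightarrow> real) \<Rightarrow> (nat \<Rightarrow> real) \<Rightarrow> real" where
  "qform n M x = dotp n x (matvec n M x)"

lemma dotp_commute: "dotp n x y = dotp n y x"
  by (simp add: dotp_def mult.commute)

lemma dotp_self_nonneg: "0 \<le> dotp n x x"
  by (auto simp: dotp_def intro!: sum_nonneg)

lemma dotp_self_eq_0_iff: "dotp n x x = 0 \<longleftrightarrow> (\<forall>i<n. x i = 0)"
  unfolding dotp_def by (subst sum_nonneg_eq_0_iff) auto

lemma dotp_self_pos_iff: "0 < dotp n x x \<longleftrightarrow> (\<exists>i<n. x i \<noteq> 0)"
  using dotp_self_nonneg[of n x] dotp_self_eq_0_iff[of n x] by force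

lemma dotp_cong: "(\<And>i. i < n \<Longrightarrow> x i = x' i) \<Longrightarrow> (\<And>i. i < n \<Longrightarrow> y i = y' i) \<Longrightarrow> dotp n x y = dotp n x' y'"
  by (simp add: dotp_def)

lemma dotp_add_scale_right: "dotp n z (\<lambda>i. x i + s * y i) = dotp n z x + s * dotp n z y"
  by (simp add: dotp_def algebra_simps sum.distrib sum_distrib_left)

lemma dotp_scale_right: "dotp n x (\<lambda>i. s * y i) = s * dotp n x y"
  by (simp add: dotp_def algebra_simps sum_distrib_left)

lemma dotp_add_scale_left: "dotp n (\<lambda>i. x i + s * y i) z = dotp n x z + s * dotp n y z"
  by (simp add: dotp_add_scale_right dotp_commute[of n _ z])

lemma dotp_scale_left: "dotp n (\<lambda>i. s * y i) x = s * dotp n y x"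
  by (simp add: dotp_scale_right dotp_commute[of n _ x])

lemma matvec_add_scale: "matvec n M (\<lambda>i. x i + s * y i) = (\<lambda>a. matvec n M x a + s * matvec n M y a)"
  by (simp add: matvec_def fun_eq_iff algebra_simps sum.distrib sum_distrib_left)

lemma matvec_scale: "matvec n M (\<lambda>i. s * y i) = (\<lambda>a. s * matvec n M y a)"
  by (simp add: matvec_def fun_eq_iff algebra_simps sum_distrib_left)

text \<open>Moves a rectangular matrix to the other side as its transpose. Orthogonality of an image
  \<open>matvec n S x\<close> to \<open>y\<close> thereby becomes a linear equation for
  \<open>x\<close>.\<close>

lemma dotp_matvec: "dotp m y (matvec n S x) = dotp n (\<lambda>b. dotp m y (\<lambda>a. S a b)) x"
proof -
  have "dotp m y (matvec n S x) = (\<Sum>a<m. \<Sum>b<n. y a * S a b * x b)"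
    by (simp add: dotp_def matvec_def sum_distrib_left mult.assoc)
  also have "\<dots> = (\<Sum>b<n. \<Sum>a<m. y a * S a b * x b)"
    by (rule sum.swap)
  finally show ?thesis
    by (simp add: dotp_def sum_distrib_right)
qed

lemma dotp_matvec_symmetric:
  assumes "\<And>a b. a < n \<Longrightarrow> b < n \<Longrightarrow> M a b = M b a"
  shows "dotp n x (matvec n M y) = dotp n (matvec n M x) y"
  unfolding dotp_matvec
  by (rule dotp_cong) (use assms in \<open>auto simp: dotp_def matvec_def intro!: sum.cong\<close>)

lemma qform_scale: "qform n M (\<lambda>i. s * x i) = s\<^sup>2 * qform n M x"
  by (simp add: qform_def matvec_scale dotp_scale_left dotp_scale_right power2_eq_square)

lemma qform_cong: "(\<And>i. i < n \<Longrightarrow> x i = y i) \<Longrightarrow> qform n M x = qform n M y"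
  by (simp add: qform_def dotp_def matvec_def)

lemma qform_add:
  "qform n (\<lambda>a b. A a b + B a b) x = qform n A x + qform n B x"
  by (simp add: qform_def dotp_def matvec_def algebra_simps sum.distrib)

text \<open>With fewer equations than unknowns, zero rows fill the coefficient matrix up to a square
  one. As \<open>m < n\<close>, row \<open>n - 1\<close> is zero, so the determinant vanishes and
  the kernel is nontrivial.\<close>

lemma homogeneous_system_nontrivial_solution:
  fixes A :: "nat \<Rightarrow> nat \<Rightarrow> real"
  assumes "m < n"
  obtains v where "0 < dotp n v v" "\<And>i. i < m \<Longrightarrow> dotp n (A i) v = 0"
proof -
  define B where "B = mat\<^sub>r n n (\<lambda>i. if i = n - 1 then 0\<^sub>v n else vec n (if i < m then A i else (\<lambda>_. 0)))"
  have B: "B \<in> carrier_mat n n"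
    by (simp add: B_def)
  have "det B = 0"
    unfolding B_def by (rule det_row_0) (use assms in auto)
  then obtain w where w: "w \<in> carrier_vec n" "w \<noteq> 0\<^sub>v n" "B *\<^sub>v w = 0\<^sub>v n"
    using det_0_iff_vec_prod_zero[OF B] by blast
  define v where "v = (\<lambda>i. w $ i)"
  have "\<exists>i<n. v i \<noteq> 0"
  proof (rule ccontr)
    assume "\<not> ?thesis"
    then have "w = 0\<^sub>v n"
      using w(1) by (intro eq_vecI) (auto simp: v_def)
    with w(2) show False by simp
  qed
  moreover have "dotp n (A i) v = 0" if "i < m" for i
  proof -
    have "0 = (B *\<^sub>v w) $ i"
      using w(3) that assms by simp
    also have "\<dots> = row B i \<bullet> w"
      using B that assms by (simp add: index_mult_mat_vec)
    also have "row B i = vec n (A i)"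
      using that assms by (auto simp: B_def)
    finally show ?thesis
      using w(1) by (simp add: scalar_prod_def dotp_def v_def atLeast0LessThan)
  qed
  ultimately show ?thesis
    using that dotp_self_pos_iff by blast
qed

section \<open>Spectral decomposition of real symmetric matrices\<close>

text \<open>Indices start at 0, so \<open>d 0\<close> is the largest eigenvalue and
  \<open>mu i\<close> will correspond to \<open>d (i - 1)\<close>.\<close>

locale eigensystem =
  fixes n :: nat and M :: "nat \<Rightarrow> nat \<Rightarrow> real" and d :: "nat \<Rightarrow> real" and u :: "nat \<Rightarrow> nat \<Rightarrow> real"
  assumes sym: "a < n \<Longrightarrow> b < n \<Longrightarrow> M a b = M b a"
    and orthonormal: "i < n \<Longrightarrow> j < n \<Longrightarrow> dotp n (u i) (u j) = (if i = j then 1 else 0)"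
    and eigen: "i < n \<Longrightarrow> a < n \<Longrightarrow> matvec n M (u i) a = d i * u i a"
    and decreasing: "i \<le> j \<Longrightarrow> j < n \<Longrightarrow> d j \<le> d i"

text \<open>Near \<open>s = 0\<close> the linear term beats the quadratic one, so a positive
  \<open>R\<close> would make the expression positive for small positive \<open>s\<close>.\<close>

lemma linear_dominated_by_quadratic:
  fixes R C :: real
  assumes "\<And>s. 2 * s * R + s\<^sup>2 * C \<le> 0" "0 \<le> R"
  shows "R = 0"
proof (rule ccontr)
  assume "R \<noteq> 0"
  with assms(2) have R: "R > 0" by simp
  \<comment> \<open>This choice gives \<bar>s C\<bar> \<le> R, hence 2 R + s C \<ge> R > 0; the
    added 1 covers \<open>C = 0\<close>.\<close>
  define s where "s = R / (\<bar>C\<bar> + 1)"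
  have s: "s > 0" "s * (\<bar>C\<bar> + 1) = R"
    using R by (auto simp: s_def)
  have "s * (2 * R + s * C) \<le> 0"
    using assms(1)[of s] by (simp add: algebra_simps power2_eq_square)
  then have "2 * R + s * C \<le> 0"
    using s(1) by (simp add: mult_le_0_iff)
  moreover have "- (s * C) \<le> s * (\<bar>C\<bar> + 1)"
    using s(1) by (smt (verit) mult_left_mono mult_minus_right abs_ge_minus_self)
  ultimately show False
    using s R by linarith
qed

text \<open>Compactness refers to the product topology on functions. Forcing the coordinates from
  \<open>n\<close> on to be 0 places the set inside a product of compact intervals, where it is cut
  out by closed conditions.\<close>

lemma compact_unit_sphere_orthogonal:
  "compact {v :: nat \<Rightarrow> real. (\<forall>i\<ge>n. v i = 0) \<and> dotp n v v = 1 \<and> (\<forall>i<m. dotp n (u i) v = 0)}"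
    (is "compact ?K")
proof -
  define B where "B = PiE UNIV (\<lambda>i. if i < n then {-1..1} else {0 :: real})"
  have cont: "continuous_on S (\<lambda>v :: nat \<Rightarrow> real. v i)" for S i
    by (rule continuous_on_subset[OF continuous_on_product_coordinates]) simp
  have "compactin (product_topology (\<lambda>i. euclidean) UNIV) B"
    unfolding B_def by (subst compactin_PiE) auto
  then have B: "compact B"
    by (simp add: euclidean_product_topology)
  have "closed {v :: nat \<Rightarrow> real. dotp n v v = 1 \<and> (\<forall>i<m. dotp n (u i) v = 0)}"
    unfolding dotp_def
    by (intro closed_Collect_conj closed_Collect_all closed_Collect_imp closed_Collect_eq
        continuous_intros cont) auto
  then have "compact (B \<inter> {v. dotp n v v = 1 \<and> (\<forall>i<m. dotp n (u i) v = 0)})"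
    by (rule compact_Int_closed[OF B])
  moreover have "?K = B \<inter> {v. dotp n v v = 1 \<and> (\<forall>i<m. dotp n (u i) v = 0)}"
  proof -
    have "v \<in> B" if v: "\<forall>i\<ge>n. v i = 0" "dotp n v v = 1" for v
    proof -
      have "v i * v i \<le> 1" if "i < n" for i
        unfolding v(2)[symmetric] dotp_def by (rule member_le_sum) (use that in auto)
      then have "\<bar>v i\<bar> \<le> 1" if "i < n" for i
        using that abs_square_le_1[of "v i"] by (simp add: power2_eq_square)
      then show ?thesis
        using v(1) by (auto simp: B_def abs_le_iff)
    qed
    moreover have "v i = 0" if "v \<in> B" "i \<ge> n" for v i
      using that by (auto simp: B_def PiE_iff dest!: spec[of _ i])
    ultimately show ?thesis by blast
  qed
  ultimately show ?thesis by simp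
qed

text \<open>The new eigenvector maximises the quadratic form on the unit sphere of the orthogonal
  complement of the previous ones; compactness supplies the maximiser. The last conclusion records
  its maximality, from which the order of the eigenvalues will follow.\<close>

lemma orthonormal_eigenvectors_extend:
  assumes sym: "\<And>a b. a < n \<Longrightarrow> b < n \<Longrightarrow> M a b = M b a"
    and "m < n"
    and eig: "\<And>i a. i < m \<Longrightarrow> a < n \<Longrightarrow> matvec n M (u i) a = d i * u i a"
  obtains v l where "dotp n v v = 1" "\<And>i. i < m \<Longrightarrow> dotp n (u i) v = 0"
    "\<And>a. a < n \<Longrightarrow> matvec n M v a = l * v a"
    "\<And>w. (\<And>i. i < m \<Longrightarrow> dotp n (u i) w = 0) \<Longrightarrow> qform n M w \<le> l * dotp n w w"
proof -
  define K where "K = {v :: nat \<Rightarrow> real. (\<forall>i\<ge>n. v i = 0) \<and> dotp n v v = 1 \<and> (\<forall>i<m. dotp n (u i) v = 0)}"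
  have cont: "continuous_on S (\<lambda>v :: nat \<Rightarrow> real. v i)" for S i
    by (rule continuous_on_subset[OF continuous_on_product_coordinates]) simp
  \<comment> \<open>Besides rescaling to length 1, the coordinates from \<open>n\<close> on are
    erased, since membership in \<open>K\<close> demands that they vanish.\<close>
  define nrm where "nrm w = (\<lambda>i. inverse (sqrt (dotp n w w)) * (if i < n then w i else 0))" for w
  have nrm: "nrm w \<in> K" "qform n M (nrm w) = qform n M w / dotp n w w"
    if "0 < dotp n w w" "\<And>i. i < m \<Longrightarrow> dotp n (u i) w = 0" for w
  proof -
    have *: "dotp n x (\<lambda>i. if i < n then w i else 0) = dotp n x w"
      "dotp n (\<lambda>i. if i < n then w i else 0) x = dotp n w x" for x
      by (auto intro: dotp_cong)
    have "dotp n (nrm w) (nrm w) = 1" "\<And>i. i < m \<Longrightarrow> dotp n (u i) (nrm w) = 0"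
      using that unfolding nrm_def dotp_scale_left dotp_scale_right * by (simp_all add: field_simps)
    then show "nrm w \<in> K"
      by (simp add: K_def) (simp add: nrm_def)
    have "qform n M (\<lambda>i. if i < n then w i else 0) = qform n M w"
      by (rule qform_cong) simp
    then show "qform n M (nrm w) = qform n M w / dotp n w w"
      using that unfolding nrm_def qform_scale power_inverse
      by (simp add: dotp_self_nonneg divide_inverse mult.commute)
  qed
  obtain w0 where "0 < dotp n w0 w0" "\<And>i. i < m \<Longrightarrow> dotp n (u i) w0 = 0"
    using homogeneous_system_nontrivial_solution[OF \<open>m < n\<close>] by metis
  then have "K \<noteq> {}"
    using nrm(1) by blast
  have "compact K"
    unfolding K_def by (rule compact_unit_sphere_orthogonal)
  have "continuous_on K (qform n M)"
    unfolding qform_def dotp_def matvec_def by (intro continuous_intros cont)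
  from continuous_attains_sup[OF \<open>compact K\<close> \<open>K \<noteq> {}\<close> this]
  obtain v where v: "v \<in> K" "\<And>w. w \<in> K \<Longrightarrow> qform n M w \<le> qform n M v"
    by metis
  define l where "l = qform n M v"
  have max: "qform n M w \<le> l * dotp n w w" if "\<And>i. i < m \<Longrightarrow> dotp n (u i) w = 0" for w
  proof (cases "dotp n w w = 0")
    case True
    then have "w i = 0" if "i < n" for i
      using that by (simp add: dotp_self_eq_0_iff)
    then have "qform n M w = 0"
      unfolding qform_def by (simp add: dotp_def)
    with True show ?thesis
      by simp
  next
    case False
    then have "0 < dotp n w w"
      using dotp_self_nonneg[of n w] by linarith
    then show ?thesis
      using v(2)[of "nrm w"] nrm[of w] that by (simp add: l_def pos_divide_le_eq)
  qed
  have v1: "dotp n v v = 1" and vu: "\<And>i. i < m \<Longrightarrow> dotp n (u i) v = 0"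
    using v(1) by (auto simp: K_def)
  \<comment> \<open>the residual is a feasible direction, so stationarity forces it to vanish\<close>
  define r where "r = (\<lambda>a. matvec n M v a + (- l) * v a)"
  have ru: "dotp n (u i) r = 0" if "i < m" for i
  proof -
    have "dotp n (u i) (matvec n M v) = dotp n (matvec n M (u i)) v"
      by (rule dotp_matvec_symmetric[OF sym])
    also have "\<dots> = dotp n (\<lambda>a. d i * u i a) v"
      by (rule dotp_cong) (use eig that in auto)
    also have "\<dots> = 0"
      by (simp add: dotp_scale_left vu that)
    finally show ?thesis
      unfolding r_def by (simp only: dotp_add_scale_right vu that)
  qed
  have rr: "dotp n r (matvec n M v) = dotp n r r + l * dotp n r v"
    unfolding r_def by (simp only: dotp_add_scale_right)
  \<comment> \<open>Maximality is tested at v + s r. The constant terms \<open>l\<close> cancel, and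
    by \<open>rr\<close> the coefficient of 2 s that remains is the squared length of the
    residual.\<close>
  have "2 * s * dotp n r r + s\<^sup>2 * (qform n M r - l * dotp n r r) \<le> 0" for s
  proof -
    have "qform n M (\<lambda>i. v i + s * r i) \<le> l * dotp n (\<lambda>i. v i + s * r i) (\<lambda>i. v i + s * r i)"
      by (rule max) (simp add: dotp_add_scale_right vu ru)
    moreover have "qform n M (\<lambda>i. v i + s * r i) =
        l + 2 * s * dotp n r (matvec n M v) + s\<^sup>2 * qform n M r"
    proof -
      have "dotp n v (matvec n M r) = dotp n r (matvec n M v)"
        using dotp_matvec_symmetric[OF sym, where x = v and y = r] dotp_commute[of n "matvec n M v" r]
        by simp
      then show ?thesis
        unfolding qform_def l_def matvec_add_scale dotp_add_scale_left dotp_add_scale_right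
        by (simp add: algebra_simps power2_eq_square)
    qed
    moreover have "dotp n (\<lambda>i. v i + s * r i) (\<lambda>i. v i + s * r i) =
        1 + 2 * s * dotp n r v + s\<^sup>2 * dotp n r r"
      unfolding dotp_add_scale_left dotp_add_scale_right v1 dotp_commute[of n v r]
      by (simp add: algebra_simps power2_eq_square)
    ultimately show ?thesis
      unfolding rr by (simp add: algebra_simps)
  qed
  then have "dotp n r r = 0"
    by (rule linear_dominated_by_quadratic) (rule dotp_self_nonneg)
  then have "matvec n M v a = l * v a" if "a < n" for a
    using that by (auto simp: dotp_self_eq_0_iff r_def)
  then show ?thesis
    using that v1 vu max by blast
qed

text \<open>Induction on the number of eigenvectors already found. The invariant keeps the
  maximality of every \<open>d i\<close>, because testing it with a later eigenvector
  \<open>u j\<close> yields d j \<le> d i.\<close>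

theorem eigensystem_exists:
  assumes sym: "\<And>a b. a < n \<Longrightarrow> b < n \<Longrightarrow> M a b = M b a"
  obtains d u where "eigensystem n M d u"
proof -
  have "\<exists>d u. (\<forall>i<m. \<forall>j<m. dotp n (u i) (u j) = (if i = j then 1 else 0)) \<and>
      (\<forall>i<m. \<forall>a<n. matvec n M (u i) a = d i * u i a) \<and>
      (\<forall>i<m. \<forall>w. (\<forall>j<i. dotp n (u j) w = 0) \<longrightarrow> qform n M w \<le> d i * dotp n w w)"
    if "m \<le> n" for m
    using that
  proof (induction m)
    case 0
    then show ?case by simp
  next
    case (Suc m)
    then have "m \<le> n" by simp
    from Suc.IH[OF this] obtain d u where
      "(\<forall>i<m. \<forall>j<m. dotp n (u i) (u j) = (if i = j then 1 else 0)) \<and>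
      (\<forall>i<m. \<forall>a<n. matvec n M (u i) a = d i * u i a) \<and>
      (\<forall>i<m. \<forall>w. (\<forall>j<i. dotp n (u j) w = 0) \<longrightarrow> qform n M w \<le> d i * dotp n w w)"
      by (elim exE)
    then have IH: "\<And>i j. i < m \<Longrightarrow> j < m \<Longrightarrow> dotp n (u i) (u j) = (if i = j then 1 else 0)"
      "\<And>i a. i < m \<Longrightarrow> a < n \<Longrightarrow> matvec n M (u i) a = d i * u i a"
      "\<And>i w. i < m \<Longrightarrow> (\<forall>j<i. dotp n (u j) w = 0) \<Longrightarrow> qform n M w \<le> d i * dotp n w w"
      by blast+
    obtain v l where v: "dotp n v v = 1" "\<And>i. i < m \<Longrightarrow> dotp n (u i) v = 0"
      "\<And>a. a < n \<Longrightarrow> matvec n M v a = l * v a"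
      "\<And>w. (\<And>i. i < m \<Longrightarrow> dotp n (u i) w = 0) \<Longrightarrow> qform n M w \<le> l * dotp n w w"
      using orthonormal_eigenvectors_extend[of n M m u d] sym IH(2) Suc.prems
      by (metis Suc_le_lessD)
    have v': "dotp n v (u i) = 0" if "i < m" for i
      using v(2)[OF that] by (simp add: dotp_commute)
    show ?case
      by (rule exI[of _ "d(m := l)"], rule exI[of _ "u(m := v)"])
        (use IH v v' in \<open>auto simp: less_Suc_eq\<close>)
  qed
  from this[OF order_refl] obtain d u where
    "(\<forall>i<n. \<forall>j<n. dotp n (u i) (u j) = (if i = j then 1 else 0)) \<and>
    (\<forall>i<n. \<forall>a<n. matvec n M (u i) a = d i * u i a) \<and>
    (\<forall>i<n. \<forall>w. (\<forall>j<i. dotp n (u j) w = 0) \<longrightarrow> qform n M w \<le> d i * dotp n w w)"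
    by (elim exE)
  then have ex: "\<And>i j. i < n \<Longrightarrow> j < n \<Longrightarrow> dotp n (u i) (u j) = (if i = j then 1 else 0)"
    "\<And>i a. i < n \<Longrightarrow> a < n \<Longrightarrow> matvec n M (u i) a = d i * u i a"
    "\<And>i w. i < n \<Longrightarrow> (\<forall>j<i. dotp n (u j) w = 0) \<Longrightarrow> qform n M w \<le> d i * dotp n w w"
    by blast+
  have "d j \<le> d i" if "i \<le> j" "j < n" for i j
  proof -
    have "d j = qform n M (u j)"
      using ex(1)[of j j] ex(2)[of j] that
      by (simp add: qform_def dotp_scale_right flip: dotp_cong[of n "u j" "u j" "\<lambda>a. d j * u j a" "matvec n M (u j)"])
    also have "\<dots> \<le> d i * dotp n (u j) (u j)"
      by (rule ex(3)) (use ex(1) that in auto)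
    finally show ?thesis
      using ex(1)[of j j] that by simp
  qed
  then have "eigensystem n M d u"
    by unfold_locales (use sym ex in auto)
  then show ?thesis
    using that by blast
qed

lemma proots_prod_linear_factors:
  "proots (\<Prod>e\<leftarrow>es. [:- e, 1:] :: 'a :: idom poly) = mset es"
proof (induction es)
  case (Cons e es)
  have "(\<Prod>e\<leftarrow>es. [:- e, 1:]) \<noteq> 0"
    by (auto simp: prod_list_zero_iff)
  then show ?case
    using Cons by (simp add: proots_mult proots_linear_factor del: mult_pCons_left)
qed simp

section \<open>Expansions in an orthonormal eigenbasis\<close>

context eigensystem
begin

text \<open>Orthonormality says that the square matrix with rows \<open>u i\<close> has its
  transpose as right inverse. It is then also a left inverse, so the columns are orthonormal
  too.\<close>

lemma completeness:
  assumes "a < n" "b < n"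
  shows "(\<Sum>i<n. u i a * u i b) = (if a = b then 1 else 0)"
proof -
  define U where "U = mat n n (\<lambda>(i, j). u i j)"
  have U: "U \<in> carrier_mat n n" "U\<^sup>T \<in> carrier_mat n n"
    by (auto simp: U_def)
  have "U * U\<^sup>T = 1\<^sub>m n"
    by (rule eq_matI) (use orthonormal in \<open>auto simp: U_def scalar_prod_def dotp_def atLeast0LessThan\<close>)
  from mat_mult_left_right_inverse[OF U this] have "(U\<^sup>T * U) $$ (a, b) = 1\<^sub>m n $$ (a, b)"
    by simp
  then show ?thesis
    using assms by (simp add: U_def scalar_prod_def atLeast0LessThan)
qed

lemma parseval: "dotp n x y = (\<Sum>i<n. dotp n (u i) x * dotp n (u i) y)"
proof -
  have "(\<Sum>i<n. dotp n (u i) x * dotp n (u i) y) = (\<Sum>i<n. \<Sum>a<n. \<Sum>b<n. u i a * x a * (u i b * y b))"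
    by (simp add: dotp_def sum_product)
  also have "\<dots> = (\<Sum>a<n. \<Sum>i<n. \<Sum>b<n. u i a * x a * (u i b * y b))"
    by (rule sum.swap)
  also have "\<dots> = (\<Sum>a<n. \<Sum>b<n. \<Sum>i<n. u i a * x a * (u i b * y b))"
    by (intro sum.cong refl sum.swap)
  also have "\<dots> = (\<Sum>a<n. \<Sum>b<n. x a * y b * (\<Sum>i<n. u i a * u i b))"
    by (simp add: sum_distrib_left mult_ac)
  also have "\<dots> = (\<Sum>a<n. \<Sum>b<n. if a = b then x a * y a else 0)"
    by (intro sum.cong refl) (simp add: completeness)
  also have "\<dots> = dotp n x y"
    by (simp add: dotp_def)
  finally show ?thesis ..
qed

lemma parseval_self: "dotp n x x = (\<Sum>i<n. (dotp n (u i) x)\<^sup>2)"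
  using parseval[of x x] by (simp add: power2_eq_square)

lemma dotp_eigenvector_matvec:
  assumes "i < n"
  shows "dotp n (u i) (matvec n M x) = d i * dotp n (u i) x"
proof -
  have "dotp n (u i) (matvec n M x) = dotp n (matvec n M (u i)) x"
    by (rule dotp_matvec_symmetric[OF sym])
  also have "\<dots> = dotp n (\<lambda>a. d i * u i a) x"
    by (rule dotp_cong) (use eigen assms in auto)
  finally show ?thesis
    by (simp add: dotp_scale_left)
qed

lemma qform_expansion: "qform n M x = (\<Sum>i<n. d i * (dotp n (u i) x)\<^sup>2)"
  unfolding qform_def parseval[of x "matvec n M x"]
  by (intro sum.cong refl) (simp add: dotp_eigenvector_matvec power2_eq_square)

text \<open>In the eigenbasis only the weights \<open>d i\<close> with i \<ge> j survive, and none
  exceeds \<open>d j\<close>. This and its counterpart for trailing eigenvectors are the two halves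
  of the Courant-Fischer principle.\<close>

lemma qform_le_if_orthogonal_leading:
  assumes "j < n" "\<And>i. i < j \<Longrightarrow> dotp n (u i) x = 0"
  shows "qform n M x \<le> d j * dotp n x x"
proof -
  have "d i * (dotp n (u i) x)\<^sup>2 \<le> d j * (dotp n (u i) x)\<^sup>2" if "i < n" for i
    using assms(2)[of i] decreasing[of j i] that by (cases "i < j") (auto intro: mult_right_mono)
  then show ?thesis
    unfolding qform_expansion parseval_self sum_distrib_left by (intro sum_mono) auto
qed

lemma qform_ge_if_orthogonal_trailing:
  assumes "j < n" "\<And>i. j < i \<Longrightarrow> i < n \<Longrightarrow> dotp n (u i) x = 0"
  shows "d j * dotp n x x \<le> qform n M x"
proof -
  have "d j * (dotp n (u i) x)\<^sup>2 \<le> d i * (dotp n (u i) x)\<^sup>2" if "i < n" for i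
    using assms(2)[of i] decreasing[of i j] that assms(1) by (cases "j < i") (auto intro: mult_right_mono)
  then show ?thesis
    unfolding qform_expansion parseval_self sum_distrib_left by (intro sum_mono) auto
qed

text \<open>Parseval is applied to every row of the matrix: the coefficient of row \<open>a\<close>
  along \<open>u i\<close> is entry \<open>a\<close> of the image of \<open>u i\<close>, that is
  \<open>d i * u i a\<close>.\<close>

lemma sum_eigenvalues_squared: "(\<Sum>i<n. (d i)\<^sup>2) = (\<Sum>a<n. \<Sum>b<n. (M a b)\<^sup>2)"
proof -
  have "(\<Sum>a<n. \<Sum>b<n. (M a b)\<^sup>2) = (\<Sum>a<n. dotp n (M a) (M a))"
    by (simp add: dotp_def power2_eq_square)
  also have "\<dots> = (\<Sum>a<n. \<Sum>i<n. (dotp n (u i) (M a))\<^sup>2)"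
    by (simp add: parseval_self)
  also have "\<dots> = (\<Sum>a<n. \<Sum>i<n. (d i * u i a)\<^sup>2)"
    by (intro sum.cong refl arg_cong[where f = "\<lambda>x. x\<^sup>2"])
      (simp add: dotp_def matvec_def mult.commute flip: eigen)
  also have "\<dots> = (\<Sum>i<n. \<Sum>a<n. (d i * u i a)\<^sup>2)"
    by (rule sum.swap)
  also have "\<dots> = (\<Sum>i<n. (d i)\<^sup>2 * dotp n (u i) (u i))"
    by (simp add: dotp_def power2_eq_square sum_distrib_left mult_ac)
  also have "\<dots> = (\<Sum>i<n. (d i)\<^sup>2)"
    by (simp add: orthonormal)
  finally show ?thesis ..
qed

text \<open>The eigenvectors diagonalise the matrix by an orthogonal similarity, which preserves the
  characteristic polynomial. This ties algebraic multiplicities to repetitions in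
  \<open>d\<close>.\<close>

lemma char_poly_eq:
  assumes A: "A \<in> carrier_mat n n" "\<And>a b. a < n \<Longrightarrow> b < n \<Longrightarrow> A $$ (a, b) = M a b"
  shows "char_poly A = (\<Prod>e\<leftarrow>map d [0..<n]. [:- e, 1:])"
proof -
  define U where "U = mat n n (\<lambda>(i, j). u i j)"
  define D where "D = mat n n (\<lambda>(i, j). if i = j then d i else 0)"
  have U: "U \<in> carrier_mat n n" "U\<^sup>T \<in> carrier_mat n n" and D: "D \<in> carrier_mat n n"
    by (auto simp: U_def D_def)
  have UU: "U * U\<^sup>T = 1\<^sub>m n"
    by (rule eq_matI) (use orthonormal in \<open>auto simp: U_def scalar_prod_def dotp_def atLeast0LessThan\<close>)
  have UU': "U\<^sup>T * U = 1\<^sub>m n"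
    by (rule mat_mult_left_right_inverse[OF U UU])
  have "A * U\<^sup>T = U\<^sup>T * D"
  proof (rule eq_matI)
    fix a i assume "a < dim_row (U\<^sup>T * D)" "i < dim_col (U\<^sup>T * D)"
    then have ai: "a < n" "i < n"
      using U D by auto
    have "(A * U\<^sup>T) $$ (a, i) = matvec n M (u i) a"
      using ai A by (auto simp: U_def scalar_prod_def matvec_def atLeast0LessThan)
    also have "\<dots> = (\<Sum>j<n. if j = i then u i a * d i else 0)"
      using ai by (simp add: eigen)
    also have "\<dots> = (\<Sum>j<n. u j a * (if j = i then d j else 0))"
      by (rule sum.cong) auto
    also have "\<dots> = (U\<^sup>T * D) $$ (a, i)"
      using ai by (simp add: U_def D_def scalar_prod_def atLeast0LessThan)
    finally show "(A * U\<^sup>T) $$ (a, i) = (U\<^sup>T * D) $$ (a, i)" .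
  qed (use A U D in auto)
  then have "A = U\<^sup>T * D * U"
    using A(1) U UU' by (metis assoc_mult_mat right_mult_one_mat)
  then have "similar_mat A D"
    unfolding similar_mat_def by (intro exI) (rule similar_mat_witI[OF UU' UU _ A(1) D U(2,1)])
  then have "char_poly A = char_poly D"
    by (rule char_poly_similar)
  also have "\<dots> = (\<Prod>e\<leftarrow>diag_mat D. [:- e, 1:])"
    by (rule char_poly_upper_triangular[OF D]) (auto simp: D_def upper_triangular_def)
  also have "diag_mat D = map d [0..<n]"
    by (auto simp: diag_mat_def D_def)
  finally show ?thesis .
qed

text \<open>A change of sign reverses the order of the eigenvalues; the index
  \<open>n - 1 - i\<close> restores it.\<close>

lemma negated: "eigensystem n (\<lambda>a b. - M a b) (\<lambda>i. - d (n - 1 - i)) (\<lambda>i. u (n - 1 - i))"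
proof
  fix i a assume "i < n" "a < n"
  moreover have "matvec n (\<lambda>a b. - M a b) x a = - matvec n M x a" for x
    by (simp add: matvec_def sum_negf)
  ultimately show "matvec n (\<lambda>a b. - M a b) (u (n - 1 - i)) a = - d (n - 1 - i) * u (n - 1 - i) a"
    by (simp add: eigen)
next
  fix i j assume "i < n" "j < n"
  then show "dotp n (u (n - 1 - i)) (u (n - 1 - j)) = (if i = j then 1 else 0)"
    by (subst orthonormal) auto
qed (use sym decreasing in auto)

end

text \<open>The roots of the characteristic polynomial do not depend on an eigenbasis, so the
  eigenvalues may be read off any eigensystem of the matrix.\<close>

lemma eigenvalue_list_eq:
  assumes "eigensystem (gorder G) M d u"
    and "\<And>a b. a < gorder G \<Longrightarrow> b < gorder G \<Longrightarrow> adjacency_matrix G $$ (a, b) = M a b"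
  shows "eigenvalue_list G = map d [0..<gorder G]"
proof -
  interpret eigensystem "gorder G" M d u by fact
  let ?ds = "map d [0..<gorder G]"
  have "adjacency_matrix G \<in> carrier_mat (gorder G) (gorder G)"
    by (simp add: adjacency_matrix_def)
  from char_poly_eq[OF this assms(2)] have "proots (char_poly (adjacency_matrix G)) = mset ?ds"
    by (simp only: proots_prod_linear_factors)
  moreover have "sort ?ds = rev ?ds"
  proof (rule properties_for_sort)
    show "sorted (rev ?ds)"
      by (auto simp: sorted_rev_iff_nth_mono intro: decreasing)
  qed simp
  ultimately show ?thesis
    by (simp only: eigenvalue_list_def sorted_list_of_multiset_mset rev_rev_ident)
qed

section \<open>Comparison of eigenvalues\<close>

text \<open>
  Dimension count behind the Courant-Fischer principle: the first j + 1 eigenvectors of M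
  span a vector whose image is orthogonal to the first j eigenvectors of B.
\<close>

lemma eigenvalue_comparison_vector:
  assumes "eigensystem n M d u" "eigensystem N B e w" "j < n" "j < N"
  obtains c where "0 < dotp n c c" "d j * dotp n c c \<le> qform n M c"
    "qform N B (matvec n S c) \<le> e j * dotp N (matvec n S c) (matvec n S c)"
proof -
  interpret M: eigensystem n M d u by fact
  interpret B: eigensystem N B e w by fact
  \<comment> \<open>There are \<open>n - 1\<close> equations: \<open>j\<close> of them make the
    image orthogonal to \<open>w 0\<close>, ..., \<open>w (j - 1)\<close>, the others make
    \<open>c\<close> orthogonal to \<open>u (j + 1)\<close>, ..., \<open>u (n - 1)\<close>. The
    shift \<open>Suc i\<close> skips \<open>u j\<close>.\<close>
  define A where "A i = (if i < j then (\<lambda>b. dotp N (w i) (\<lambda>a. S a b)) else u (Suc i))" for i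
  have "n - 1 < n"
    using \<open>j < n\<close> by simp
  then obtain c where c: "0 < dotp n c c" "\<And>i. i < n - 1 \<Longrightarrow> dotp n (A i) c = 0"
    using homogeneous_system_nontrivial_solution by blast
  have "dotp n (u i) c = 0" if "j < i" "i < n" for i
    using c(2)[of "i - 1"] that by (cases i) (auto simp: A_def split: if_splits)
  moreover have "dotp N (w i) (matvec n S c) = 0" if "i < j" for i
    using c(2)[of i] that \<open>j < n\<close> by (simp add: A_def dotp_matvec)
  ultimately show ?thesis
    using that c(1) M.qform_ge_if_orthogonal_trailing B.qform_le_if_orthogonal_leading assms(3,4)
    by blast
qed

text \<open>Cauchy-Schwarz is used twice: in every row, to bound the length of the image of
  \<open>x\<close>, and then for the product of \<open>x\<close> with that image.\<close>

lemma abs_qform_le_frobenius: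
  "\<bar>qform n E x\<bar> \<le> sqrt (\<Sum>a<n. \<Sum>b<n. (E a b)\<^sup>2) * dotp n x x"
proof -
  have sq: "dotp n y y = (\<Sum>i<n. (y i)\<^sup>2)" for y
    by (simp add: dotp_def power2_eq_square)
  have "(matvec n E x a)\<^sup>2 \<le> (\<Sum>b<n. (E a b)\<^sup>2) * dotp n x x" for a
    unfolding matvec_def sq by (rule Cauchy_Schwarz_ineq_sum)
  then have "dotp n (matvec n E x) (matvec n E x) \<le> (\<Sum>a<n. (\<Sum>b<n. (E a b)\<^sup>2) * dotp n x x)"
    unfolding sq[of "matvec n E x"] by (rule sum_mono)
  also have "\<dots> = (\<Sum>a<n. \<Sum>b<n. (E a b)\<^sup>2) * dotp n x x"
    by (simp add: sum_distrib_right)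
  finally have Ex: "dotp n (matvec n E x) (matvec n E x) \<le> (\<Sum>a<n. \<Sum>b<n. (E a b)\<^sup>2) * dotp n x x" .
  have "(qform n E x)\<^sup>2 \<le> dotp n x x * dotp n (matvec n E x) (matvec n E x)"
    using Cauchy_Schwarz_ineq_sum[of x "matvec n E x" "{..<n}"] by (simp add: qform_def sq) (simp add: dotp_def)
  also have "\<dots> \<le> dotp n x x * ((\<Sum>a<n. \<Sum>b<n. (E a b)\<^sup>2) * dotp n x x)"
    by (rule mult_left_mono[OF Ex dotp_self_nonneg])
  finally have "(qform n E x)\<^sup>2 \<le> (\<Sum>a<n. \<Sum>b<n. (E a b)\<^sup>2) * (dotp n x x)\<^sup>2"
    by (simp add: power2_eq_square mult_ac)
  then have "sqrt ((qform n E x)\<^sup>2) \<le> sqrt ((\<Sum>a<n. \<Sum>b<n. (E a b)\<^sup>2) * (dotp n x x)\<^sup>2)"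
    by (rule real_sqrt_le_mono)
  then show ?thesis
    by (simp add: real_sqrt_mult dotp_self_nonneg)
qed

section \<open>Eigenvalues of approximate blow-ups\<close>

lemma sum_blocks: "(\<Sum>x<n * t. f x) = (\<Sum>a<n. \<Sum>b<t. f (a * t + b :: nat))"
proof -
  have "sum f {a * t..<a * t + t} = (\<Sum>b<t. f (a * t + b))" for a
    using sum.shift_bounds_nat_ivl[of f 0 "a * t" t] by (simp add: atLeast0LessThan add.commute)
  then show ?thesis
    by (simp flip: sum.nat_group)
qed

lemma sum_truncate:
  fixes f :: "nat \<Rightarrow> real"
  assumes "m \<le> N" "\<And>x. m \<le> x \<Longrightarrow> x < N \<Longrightarrow> f x = 0"
  shows "(\<Sum>x<N. f x) = (\<Sum>x<m. f x)"
  by (rule sum.mono_neutral_right) (use assms in auto)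

text \<open>The Kronecker product of \<open>M\<close> with the all-ones matrix of size
  \<open>t\<close>, padded with zeros.\<close>

definition block_extend :: "nat \<Rightarrow> nat \<Rightarrow> (nat \<Rightarrow> nat \<Rightarrow> real) \<Rightarrow> nat \<Rightarrow> nat \<Rightarrow> real" where
  "block_extend n t M x y = (if x < n * t \<and> y < n * t then M (x div t) (y div t) else 0)"

text \<open>Spreads coordinate \<open>a\<close> evenly over block \<open>a\<close>. The factor makes
  the columns orthonormal, so that the map is an isometry.\<close>

definition block_lift :: "nat \<Rightarrow> nat \<Rightarrow> nat \<Rightarrow> nat \<Rightarrow> real" where
  "block_lift n t x a = (if x < n * t \<and> x div t = a then 1 / sqrt t else 0)"

lemma matvec_block_lift:
  assumes "0 < t"
  shows "matvec n (block_lift n t) c x = (if x < n * t then c (x div t) / sqrt t else 0)"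
proof (cases "x < n * t")
  case True
  then have "x div t < n"
    by (simp add: less_mult_imp_div_less)
  have "matvec n (block_lift n t) c x = (\<Sum>a<n. if a = x div t then c (x div t) / sqrt t else 0)"
    unfolding matvec_def block_lift_def by (intro sum.cong) (use True in auto)
  then show ?thesis
    using True \<open>x div t < n\<close> by simp
qed (simp add: matvec_def block_lift_def)

lemma matvec_block_lift_transpose:
  assumes "0 < t" "n * t \<le> N" "a < n"
  shows "matvec N (\<lambda>a x. block_lift n t x a) w a = (\<Sum>b<t. w (a * t + b)) / sqrt t"
proof -
  have "matvec N (\<lambda>a x. block_lift n t x a) w a = (\<Sum>x<n * t. block_lift n t x a * w x)"
    unfolding matvec_def by (rule sum_truncate) (use assms in \<open>auto simp: block_lift_def\<close>)
  also have "\<dots> = (\<Sum>a'<n. \<Sum>b<t. block_lift n t (a' * t + b) a * w (a' * t + b))"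
    by (rule sum_blocks)
  also have "\<dots> = (\<Sum>a'<n. if a' = a then (\<Sum>b<t. w (a * t + b)) / sqrt t else 0)"
  proof (intro sum.cong refl)
    fix a' assume "a' \<in> {..<n}"
    then have "Suc a' * t \<le> n * t"
      by (intro mult_le_mono1) auto
    then have "a' * t + b < n * t" if "b < t" for b
      using that by simp
    then show "(\<Sum>b<t. block_lift n t (a' * t + b) a * w (a' * t + b)) =
        (if a' = a then (\<Sum>b<t. w (a * t + b)) / sqrt t else 0)"
      using assms(1) by (auto simp: block_lift_def sum_divide_distrib intro!: sum.cong)
  qed
  also have "\<dots> = (\<Sum>b<t. w (a * t + b)) / sqrt t"
    using assms(3) by simp
  finally show ?thesis .
qed

lemma block_index_less: "a < n \<Longrightarrow> b < t \<Longrightarrow> a * t + b < n * (t :: nat)"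
  using mult_le_mono1[of "Suc a" n t] by simp

lemma norm_block_lift:
  assumes "0 < t" "n * t \<le> N"
  shows "dotp N (matvec n (block_lift n t) c) (matvec n (block_lift n t) c) = dotp n c c"
proof -
  have "dotp N (matvec n (block_lift n t) c) (matvec n (block_lift n t) c)
      = (\<Sum>x<n * t. c (x div t) * c (x div t) / t)"
    unfolding dotp_def matvec_block_lift[OF assms(1)]
    by (subst sum_truncate[OF assms(2)]) (auto intro!: sum.cong)
  also have "\<dots> = dotp n c c"
    using assms(1) unfolding sum_blocks by (simp add: dotp_def)
  finally show ?thesis .
qed

text \<open>Within a block, Cauchy-Schwarz against the constant vector costs a factor
  \<open>t\<close>, which the square of 1 / sqrt t cancels. Coordinates outside the blocks are
  dropped, so in general the norm only decreases.\<close>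

lemma norm_block_lift_transpose:
  fixes N
  assumes "0 < t" "n * t \<le> N"
  defines "S \<equiv> \<lambda>a x. block_lift n t x a"
  shows "dotp n (matvec N S w) (matvec N S w) \<le> dotp N w w"
proof -
  have "dotp n (matvec N S w) (matvec N S w) = (\<Sum>a<n. ((\<Sum>b<t. w (a * t + b)) / sqrt t)\<^sup>2)"
    unfolding dotp_def S_def
    by (intro sum.cong refl) (simp only: matvec_block_lift_transpose[OF assms(1,2)] lessThan_iff power2_eq_square)
  also have "\<dots> \<le> (\<Sum>a<n. \<Sum>b<t. (w (a * t + b))\<^sup>2)"
  proof (rule sum_mono)
    fix a
    have "(\<Sum>b<t. w (a * t + b) * 1)\<^sup>2 \<le> (\<Sum>b<t. (w (a * t + b))\<^sup>2) * (\<Sum>b<t. 1\<^sup>2)"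
      by (rule Cauchy_Schwarz_ineq_sum)
    then show "((\<Sum>b<t. w (a * t + b)) / sqrt t)\<^sup>2 \<le> (\<Sum>b<t. (w (a * t + b))\<^sup>2)"
      using assms(1) by (simp add: power_divide divide_le_eq)
  qed
  also have "\<dots> = (\<Sum>x<n * t. (w x)\<^sup>2)"
    by (rule sum_blocks[symmetric])
  also have "\<dots> \<le> (\<Sum>x<N. (w x)\<^sup>2)"
    by (rule sum_mono2) (use assms in auto)
  also have "\<dots> = dotp N w w"
    by (simp add: dotp_def power2_eq_square)
  finally show ?thesis .
qed

lemma block_lift_transpose_lift:
  assumes "0 < t" "n * t \<le> N" "a < n"
  shows "matvec N (\<lambda>a x. block_lift n t x a) (matvec n (block_lift n t) c) a = c a"
proof -
  have "(\<Sum>b<t. matvec n (block_lift n t) c (a * t + b)) = (\<Sum>b<t. c a / sqrt t)"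
    by (intro sum.cong refl) (use assms in \<open>auto simp: matvec_block_lift block_index_less\<close>)
  then show ?thesis
    using assms by (simp add: matvec_block_lift_transpose)
qed

text \<open>With L for \<open>block_lift\<close>, the extended matrix is t times L M L^T.
  Accordingly the form depends on \<open>w\<close> only through its block sums \<sigma>.\<close>

lemma qform_block_extend:
  fixes N
  assumes "0 < t" "n * t \<le> N"
  defines "S \<equiv> \<lambda>a x. block_lift n t x a"
  shows "qform N (block_extend n t M) w = t * qform n M (matvec N S w)"
proof -
  define \<sigma> where "\<sigma> a = (\<Sum>b<t. w (a * t + b))" for a
  have mv: "matvec N (block_extend n t M) w x = (if x < n * t then \<Sum>a<n. M (x div t) a * \<sigma> a else 0)" for x
  proof -
    have "matvec N (block_extend n t M) w x = (\<Sum>y<n * t. block_extend n t M x y * w y)"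
      unfolding matvec_def by (rule sum_truncate) (use assms in \<open>auto simp: block_extend_def\<close>)
    also have "\<dots> = (\<Sum>a<n. \<Sum>b<t. block_extend n t M x (a * t + b) * w (a * t + b))"
      by (rule sum_blocks)
    also have "\<dots> = (\<Sum>a<n. \<Sum>b<t. (if x < n * t then M (x div t) a else 0) * w (a * t + b))"
      by (intro sum.cong refl) (auto simp: block_extend_def block_index_less)
    also have "\<dots> = (\<Sum>a<n. (if x < n * t then M (x div t) a else 0) * \<sigma> a)"
      by (simp only: \<sigma>_def sum_distrib_left)
    finally show ?thesis
      by simp
  qed
  have "qform N (block_extend n t M) w = (\<Sum>x<n * t. w x * (\<Sum>a<n. M (x div t) a * \<sigma> a))"
    unfolding qform_def dotp_def mv by (subst sum_truncate[OF assms(2)]) auto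
  also have "\<dots> = (\<Sum>a'<n. \<Sum>b<t. w (a' * t + b) * (\<Sum>a<n. M a' a * \<sigma> a))"
    unfolding sum_blocks by (intro sum.cong refl) auto
  also have "\<dots> = (\<Sum>a'<n. \<sigma> a' * (\<Sum>a<n. M a' a * \<sigma> a))"
    by (simp only: \<sigma>_def sum_distrib_right)
  also have "\<dots> = qform n M \<sigma>"
    by (simp add: qform_def dotp_def matvec_def)
  also have "\<dots> = qform n M (\<lambda>a. sqrt t * matvec N S w a)"
    by (rule qform_cong) (use assms in \<open>simp add: matvec_block_lift_transpose S_def \<sigma>_def\<close>)
  finally show ?thesis
    by (simp add: qform_scale)
qed

text \<open>For the lower bound a vector of length \<open>n\<close> is lifted, which keeps its norm.
  For the upper bound a vector of length \<open>N\<close> is pushed down, which may shrink it; this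
  is why a negative \<open>d j\<close> has to be replaced by 0 there.\<close>

lemma eigenvalue_near_block_extend:
  assumes M: "eigensystem n M d u" and B: "eigensystem N B e w"
    and t: "0 < t" "n * t \<le> N" and j: "j < n"
    and \<epsilon>: "sqrt (\<Sum>x<N. \<Sum>y<N. (B x y - block_extend n t M x y)\<^sup>2) \<le> \<epsilon>"
  shows "t * d j - \<epsilon> \<le> e j" and "e j \<le> t * max (d j) 0 + \<epsilon>"
proof -
  define E where "E x y = B x y - block_extend n t M x y" for x y
  have "n \<le> n * t"
    using t by simp
  then have jN: "j < N"
    using j t by linarith
  have E: "\<bar>qform N E v\<bar> \<le> \<epsilon> * dotp N v v" for v
    using abs_qform_le_frobenius[of N E v] mult_right_mono[OF \<epsilon> dotp_self_nonneg[of N v]]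
    by (simp add: E_def)
  have split: "qform N B v = qform N (block_extend n t M) v + qform N E v" for v
    by (simp add: E_def flip: qform_add)
  show "t * d j - \<epsilon> \<le> e j"
  proof -
    obtain c where c: "0 < dotp n c c" "d j * dotp n c c \<le> qform n M c"
      "qform N B (matvec n (block_lift n t) c) \<le>
        e j * dotp N (matvec n (block_lift n t) c) (matvec n (block_lift n t) c)"
      using eigenvalue_comparison_vector[OF M B j jN] by blast
    define v where "v = matvec n (block_lift n t) c"
    have v: "dotp N v v = dotp n c c"
      unfolding v_def by (rule norm_block_lift[OF t])
    have "qform n M (matvec N (\<lambda>a x. block_lift n t x a) v) = qform n M c"
      unfolding v_def by (rule qform_cong) (rule block_lift_transpose_lift[OF t])
    then have Q: "qform N (block_extend n t M) v = t * qform n M c"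
      by (simp add: qform_block_extend[OF t])
    have "t * (d j * dotp n c c) \<le> t * qform n M c"
      by (rule mult_left_mono[OF c(2)]) simp
    also have "\<dots> \<le> e j * dotp n c c + \<epsilon> * dotp n c c"
      using c(3) E[of v] split[of v] Q v by (simp flip: v_def)
    finally have "(t * d j) * dotp n c c \<le> (e j + \<epsilon>) * dotp n c c"
      by (simp add: algebra_simps)
    then show ?thesis
      using c(1) by (simp add: mult_le_cancel_right)
  qed
  show "e j \<le> t * max (d j) 0 + \<epsilon>"
  proof -
    define S where "S = (\<lambda>a x. block_lift n t x a)"
    obtain c where c: "0 < dotp N c c" "e j * dotp N c c \<le> qform N B c"
      "qform n M (matvec N S c) \<le> d j * dotp n (matvec N S c) (matvec N S c)"
      using eigenvalue_comparison_vector[OF B M jN j] by blast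
    \<comment> \<open>The factor must be nonnegative before the norm of the image can be replaced by
      the larger norm of \<open>c\<close>.\<close>
    have "d j * dotp n (matvec N S c) (matvec N S c) \<le> max (d j) 0 * dotp n (matvec N S c) (matvec N S c)"
      by (rule mult_right_mono) (auto simp: dotp_self_nonneg)
    also have "\<dots> \<le> max (d j) 0 * dotp N c c"
      unfolding S_def by (rule mult_left_mono[OF norm_block_lift_transpose[OF t]]) simp
    finally have "t * qform n M (matvec N S c) \<le> t * (max (d j) 0 * dotp N c c)"
      using c(3) by (intro mult_left_mono) auto
    then have "e j * dotp N c c \<le> (t * max (d j) 0 + \<epsilon>) * dotp N c c"
      using c(2) E[of c] split[of c] qform_block_extend[OF t, of M c]
      by (simp add: S_def algebra_simps)
    then show ?thesis
      using c(1) by (simp add: mult_le_cancel_right)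
  qed
qed

text \<open>Differences are confined to the last \<open>s\<close> rows and columns and to the
  diagonal blocks, where the extension of \<open>M\<close> is 0. Every squared difference is at most
  1, so their sum is at most 2 s N + n t^2; then s \<le> n and n t \<le> N are used.\<close>

lemma blow_up_error:
  fixes M B :: "nat \<Rightarrow> nat \<Rightarrow> real"
  assumes "0 < t" "N = n * t + s" "s < n"
    and B1: "\<And>x y. x < N \<Longrightarrow> y < N \<Longrightarrow> \<bar>B x y\<bar> \<le> 1"
    and M0: "\<And>a. a < n \<Longrightarrow> M a a = 0"
    and agree: "\<And>x y. x < n * t \<Longrightarrow> y < n * t \<Longrightarrow> x div t \<noteq> y div t \<Longrightarrow> B x y = M (x div t) (y div t)"
  shows "sqrt (\<Sum>x<N. \<Sum>y<N. (B x y - block_extend n t M x y)\<^sup>2) \<le> real N * sqrt (1 / real n + 2 * real n / real N)"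
proof -
  \<comment> \<open>Indicators of the extra rows, the extra columns and the diagonal blocks; their
    sum dominates the squared error entrywise.\<close>
  define p q r :: "nat \<Rightarrow> nat \<Rightarrow> real" where "p x y = of_bool (n * t \<le> x)" and "q x y = of_bool (n * t \<le> y)"
    and "r x y = of_bool (x < n * t \<and> y < n * t \<and> x div t = y div t)" for x y
  have N: "n * t \<le> N" "0 < N" "0 < n"
    using assms(1-3) by auto
  have tail: "(\<Sum>x<N. of_bool (n * t \<le> x)) = real s"
  proof -
    have "{x. x < N \<and> n * t \<le> x} = {n * t..<n * t + s}"
      using assms(2) by auto
    then show ?thesis
      by (simp add: of_bool_def sum.If_cases Int_def)
  qed
  have blk: "(\<Sum>y<N. r x y) = (if x < n * t then real t else 0)" for x
  proof (cases "x < n * t")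
    case True
    then have "x div t < n"
      by (simp add: less_mult_imp_div_less)
    have "(\<Sum>y<N. r x y) = (\<Sum>y<n * t. r x y)"
      by (rule sum_truncate[OF N(1)]) (simp add: r_def)
    also have "\<dots> = (\<Sum>a<n. \<Sum>b<t. r x (a * t + b))"
      by (rule sum_blocks)
    also have "\<dots> = (\<Sum>a<n. \<Sum>b<t. of_bool (a = x div t))"
      by (intro sum.cong refl) (use True in \<open>auto simp: r_def block_index_less\<close>)
    also have "\<dots> = (\<Sum>a<n. if a = x div t then real t else 0)"
      by (intro sum.cong) auto
    also have "\<dots> = real t"
      using \<open>x div t < n\<close> by simp
    finally show ?thesis
      using True by simp
  qed (simp add: r_def)
  have "(\<Sum>x<N. \<Sum>y<N. (B x y - block_extend n t M x y)\<^sup>2) \<le> (\<Sum>x<N. \<Sum>y<N. p x y + q x y + r x y)"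
  proof (intro sum_mono)
    fix x y assume "x \<in> {..<N}" "y \<in> {..<N}"
    then have xy: "x < N" "y < N" by auto
    have b: "(B x y)\<^sup>2 \<le> 1"
      using B1[OF xy] by (simp add: abs_square_le_1)
    show "(B x y - block_extend n t M x y)\<^sup>2 \<le> p x y + q x y + r x y"
    proof (cases "x < n * t \<and> y < n * t")
      case True
      then have "y div t < n"
        by (simp add: less_mult_imp_div_less)
      with True show ?thesis
        using agree[of x y] M0[of "y div t"] b
        by (cases "x div t = y div t") (auto simp: block_extend_def p_def q_def r_def)
    next
      case False
      then have "block_extend n t M x y = 0" "1 \<le> p x y + q x y + r x y"
        by (auto simp: block_extend_def p_def q_def r_def)
      then show ?thesis
        using b by simp
    qed
  qed
  also have "\<dots> = (\<Sum>x<N. \<Sum>y<N. p x y) + (\<Sum>x<N. \<Sum>y<N. q x y) + (\<Sum>x<N. \<Sum>y<N. r x y)"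
    by (simp add: sum.distrib)
  also have "(\<Sum>x<N. \<Sum>y<N. p x y) = real N * real s"
    by (simp add: p_def tail flip: sum_distrib_left)
  also have "(\<Sum>x<N. \<Sum>y<N. q x y) = real N * real s"
    by (simp add: q_def tail)
  also have "(\<Sum>x<N. \<Sum>y<N. r x y) = real n * real t * real t"
    unfolding blk by (subst sum_truncate[OF N(1)]) auto
  also have "real N * real s + real N * real s + real n * real t * real t
      \<le> real N * real n + real N * real n + real N * (real N / real n)"
  proof (intro add_mono mult_left_mono)
    have "real n * real t \<le> real N"
      using N(1) by (metis of_nat_le_iff of_nat_mult)
    moreover from this have "real t \<le> real N / real n"
      using N by (simp add: field_simps)
    ultimately show "real n * real t * real t \<le> real N * (real N / real n)"
      by (intro mult_mono) auto
  qed (use assms(3) in auto)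
  also have "\<dots> = (real N)\<^sup>2 * (1 / real n + 2 * real n / real N)"
    using N by (simp add: field_simps power2_eq_square)
  finally have "sqrt (\<Sum>x<N. \<Sum>y<N. (B x y - block_extend n t M x y)\<^sup>2) \<le> sqrt ((real N)\<^sup>2 * (1 / real n + 2 * real n / real N))"
    by (rule real_sqrt_le_mono)
  then show ?thesis
    by (simp add: real_sqrt_mult)
qed

section \<open>Bounds on eigenvalues and stability after normalisation\<close>

context eigensystem
begin

lemma sum_eigenvalues_squared_le:
  assumes "\<And>a b. a < n \<Longrightarrow> b < n \<Longrightarrow> \<bar>M a b\<bar> \<le> 1"
  shows "(\<Sum>i<n. (d i)\<^sup>2) \<le> (real n)\<^sup>2"
proof -
  have "(\<Sum>i<n. (d i)\<^sup>2) \<le> (\<Sum>a<n. \<Sum>b<n. 1)"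
    unfolding sum_eigenvalues_squared by (intro sum_mono) (use assms in \<open>auto simp: abs_square_le_1\<close>)
  then show ?thesis
    by (simp add: power2_eq_square)
qed

lemma abs_eigenvalue_le:
  assumes "\<And>a b. a < n \<Longrightarrow> b < n \<Longrightarrow> \<bar>M a b\<bar> \<le> 1" "i < n"
  shows "\<bar>d i\<bar> \<le> real n"
proof -
  have "(d i)\<^sup>2 \<le> (\<Sum>i<n. (d i)\<^sup>2)"
    by (rule member_le_sum) (use assms(2) in auto)
  with sum_eigenvalues_squared_le[OF assms(1)] have "(d i)\<^sup>2 \<le> (real n)\<^sup>2"
    by simp
  then show ?thesis
    by (simp add: abs_le_square_iff[symmetric])
qed

text \<open>If \<open>d j\<close> is negative, each of the \<open>n - k\<close> eigenvalues from
  index \<open>k\<close> on is at most \<open>d j\<close>. Each then contributes at least (d j)^2 to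
  a sum of squares that is at most n^2.\<close>

lemma leading_eigenvalue_ge:
  assumes "\<And>a b. a < n \<Longrightarrow> b < n \<Longrightarrow> \<bar>M a b\<bar> \<le> 1" "j < k" "k < n"
  shows "- (real n / sqrt (real (n - k))) \<le> d j"
proof (cases "d j < 0")
  case True
  have "real (n - k) * (d j)\<^sup>2 = (\<Sum>i\<in>{k..<n}. (d j)\<^sup>2)"
    by simp
  also have "\<dots> \<le> (\<Sum>i\<in>{k..<n}. (d i)\<^sup>2)"
  proof (rule sum_mono)
    fix i assume "i \<in> {k..<n}"
    then have "d i \<le> d j"
      using assms(2) by (intro decreasing) auto
    then show "(d j)\<^sup>2 \<le> (d i)\<^sup>2"
      using True by (simp flip: abs_le_square_iff)
  qed
  also have "\<dots> \<le> (\<Sum>i<n. (d i)\<^sup>2)"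
    by (rule sum_mono2) auto
  also have "\<dots> \<le> (real n)\<^sup>2"
    by (rule sum_eigenvalues_squared_le[OF assms(1)])
  finally have "sqrt (real (n - k) * (d j)\<^sup>2) \<le> sqrt ((real n)\<^sup>2)"
    by (rule real_sqrt_le_mono)
  then have "sqrt (real (n - k)) * - d j \<le> real n"
    using True by (simp add: real_sqrt_mult)
  then show ?thesis
    using assms(3) by (simp add: field_simps)
next
  case False
  moreover have "0 \<le> real n / sqrt (real (n - k))"
    by simp
  ultimately show ?thesis
    by linarith
qed

end

text \<open>The three error terms stem, in order, from replacing max (d j) 0 by \<open>d j\<close>,
  from the Frobenius norm of the error matrix, and from normalising by \<open>N\<close> instead of
  \<open>n * t\<close>.\<close>

lemma blow_up_eigenvalue_close:
  fixes M B :: "nat \<Rightarrow> nat \<Rightarrow> real"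
  assumes "eigensystem n M d u" "eigensystem N B e w"
    and N: "0 < t" "N = n * t + s" "s < n" and j: "j < k" "k < n"
    and M1: "\<And>a b. a < n \<Longrightarrow> b < n \<Longrightarrow> \<bar>M a b\<bar> \<le> 1"
    and B1: "\<And>x y. x < N \<Longrightarrow> y < N \<Longrightarrow> \<bar>B x y\<bar> \<le> 1"
    and M0: "\<And>a. a < n \<Longrightarrow> M a a = 0"
    and agree: "\<And>x y. x < n * t \<Longrightarrow> y < n * t \<Longrightarrow> x div t \<noteq> y div t \<Longrightarrow> B x y = M (x div t) (y div t)"
  shows "\<bar>e j / N - d j / n\<bar> \<le> 1 / sqrt (real (n - k)) + sqrt (1 / real n + 2 * real n / real N) + n / N"
proof -
  interpret M: eigensystem n M d u by fact
  define \<epsilon> where "\<epsilon> = sqrt (1 / real n + 2 * real n / real N)"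
  have jn: "j < n" and pos: "0 < n" "0 < N" and tN: "n * t \<le> N"
    using N j by auto
  have "sqrt (\<Sum>x<N. \<Sum>y<N. (B x y - block_extend n t M x y)\<^sup>2) \<le> real N * \<epsilon>"
    unfolding \<epsilon>_def by (rule blow_up_error[OF N]) (use B1 M0 agree in auto)
  note near = eigenvalue_near_block_extend[OF assms(1,2) N(1) tN jn this]
  have tn: "real t * real n \<le> real N"
    using tN by (metis mult.commute of_nat_le_iff of_nat_mult)
  have "max (d j) 0 - d j \<le> real n / sqrt (real (n - k))"
    using M.leading_eigenvalue_ge[OF M1 j] by (auto simp: max_def)
  then have "t * (max (d j) 0 - d j) \<le> t * (real n / sqrt (real (n - k)))"
    by (rule mult_left_mono) simp
  also have "\<dots> \<le> real N / sqrt (real (n - k))"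
    using divide_right_mono[OF tn, of "sqrt (real (n - k))"] by simp
  finally have up: "e j - t * d j \<le> real N / sqrt (real (n - k)) + real N * \<epsilon>"
    using near(2) by (simp add: algebra_simps)
  moreover have "- (real N / sqrt (real (n - k)) + real N * \<epsilon>) \<le> e j - t * d j"
  proof -
    have "0 \<le> real N / sqrt (real (n - k))"
      by simp
    with near(1) show ?thesis
      by linarith
  qed
  ultimately have "\<bar>e j - t * d j\<bar> \<le> real N * (1 / sqrt (real (n - k)) + \<epsilon>)"
    by (simp add: abs_le_iff algebra_simps)
  then have 1: "\<bar>(e j - t * d j) / N\<bar> \<le> 1 / sqrt (real (n - k)) + \<epsilon>"
    using pos by (simp add: field_simps abs_divide)
  have "real s * \<bar>d j\<bar> \<le> real n * real n"
    by (rule mult_mono) (use M.abs_eigenvalue_le[OF M1 jn] N(3) in auto)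
  then have 2: "\<bar>s * d j / (n * N)\<bar> \<le> n / N"
    using pos by (simp add: abs_mult abs_divide field_simps)
  \<comment> \<open>Because N = n t + s, the difference t / N - 1 / n equals - s / (n N).\<close>
  have "e j / N - d j / n = (e j - t * d j) / N - s * d j / (n * N)"
    using pos by (simp add: field_simps) (simp add: N(2) algebra_simps)
  also have "\<bar>\<dots>\<bar> \<le> \<bar>(e j - t * d j) / N\<bar> + \<bar>s * d j / (n * N)\<bar>"
    by (rule abs_triangle_ineq4)
  also have "\<dots> \<le> 1 / sqrt (real (n - k)) + \<epsilon> + n / N"
    by (rule add_mono[OF 1 2])
  finally show ?thesis
    by (simp add: \<epsilon>_def)
qed

section \<open>Padded blow-ups of graphs\<close>

text \<open>Counting from 0 makes \<open>x div t\<close> the block of index \<open>x\<close> in a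
  blow-up.\<close>

definition adj :: "nat pair_pre_digraph \<Rightarrow> nat \<Rightarrow> nat \<Rightarrow> real" where
  "adj G a b = of_bool ((Suc a, Suc b) \<in> parcs G)"

lemma abs_adj_le_1: "\<bar>adj G a b\<bar> \<le> 1"
  by (simp add: adj_def)

text \<open>Reduces membership to plain conditions on sets and relations, which are easy to check
  for complements and relabelled blow-ups.\<close>

lemma labelled_graphs_iff:
  "G \<in> labelled_graphs \<longleftrightarrow> (\<exists>n. pverts G = {1..n}) \<and> parcs G \<subseteq> pverts G \<times> pverts G \<and>
    sym (parcs G) \<and> irrefl (parcs G)"
proof
  assume "G \<in> labelled_graphs"
  then have G: "pair_graph G" "pverts G = {1..gorder G}"
    by (auto simp: labelled_graphs_def)
  interpret pair_graph G by (fact G(1))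
  show "(\<exists>n. pverts G = {1..n}) \<and> parcs G \<subseteq> pverts G \<times> pverts G \<and> sym (parcs G) \<and> irrefl (parcs G)"
    using G(2) in_arcsD1 in_arcsD2 arcs_symmetric pair_no_loops by (fastforce simp: sym_def irrefl_def)
next
  assume *: "(\<exists>n. pverts G = {1..n}) \<and> parcs G \<subseteq> pverts G \<times> pverts G \<and> sym (parcs G) \<and> irrefl (parcs G)"
  then have "finite (pverts G)"
    by auto
  moreover from this * have "finite (parcs G)"
    by (meson finite_SigmaI finite_subset)
  moreover have "symmetric (with_proj G)"
    using * by (simp add: symmetric_def)
  ultimately have "pair_graph G"
    using * by unfold_locales (auto simp: irrefl_def)
  with * show "G \<in> labelled_graphs"
    by (auto simp: labelled_graphs_def gorder_def)
qed

lemma pverts_labelled: "G \<in> labelled_graphs \<Longrightarrow> pverts G = {1..gorder G}"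
  by (simp add: labelled_graphs_def)

lemma adj_commute: "G \<in> labelled_graphs \<Longrightarrow> adj G a b = adj G b a"
  by (auto simp: labelled_graphs_iff adj_def dest: symD)

lemma adj_self: "G \<in> labelled_graphs \<Longrightarrow> adj G a a = 0"
  by (auto simp: labelled_graphs_iff adj_def irrefl_def)

lemma gorder_graph_complement [simp]: "gorder (graph_complement G) = gorder G"
  by (simp add: gorder_def graph_complement_def)

lemma graph_complement_labelled:
  "G \<in> labelled_graphs \<Longrightarrow> graph_complement G \<in> labelled_graphs"
  unfolding labelled_graphs_iff graph_complement_def by (auto simp: sym_def irrefl_def)

lemma adj_graph_complement:
  assumes "G \<in> labelled_graphs" "a < gorder G" "b < gorder G" "a \<noteq> b"
  shows "adj (graph_complement G) a b = 1 - adj G a b"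
  using assms by (auto simp: adj_def graph_complement_def pverts_labelled)

lemma adjacency_eigensystem:
  assumes "G \<in> labelled_graphs"
  obtains d u where "eigensystem (gorder G) (adj G) d u"
    "\<And>i. 1 \<le> i \<Longrightarrow> i \<le> gorder G \<Longrightarrow> mu i G = d (i - 1)"
proof -
  obtain d u where du: "eigensystem (gorder G) (adj G) d u"
    using eigensystem_exists[of "gorder G" "adj G"] adj_commute[OF assms] by blast
  have "eigenvalue_list G = map d [0..<gorder G]"
    by (rule eigenvalue_list_eq[OF du]) (simp add: adjacency_matrix_def adj_def)
  then show ?thesis
    using that du by (simp add: mu_def)
qed

lemma abs_mu_le:
  assumes "G \<in> labelled_graphs" "1 \<le> i" "i \<le> gorder G"
  shows "\<bar>mu i G\<bar> \<le> gorder G"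
proof -
  obtain d u where d: "eigensystem (gorder G) (adj G) d u" "mu i G = d (i - 1)"
    using adjacency_eigensystem[OF assms(1)] assms(2,3) by metis
  interpret eigensystem "gorder G" "adj G" d u by (fact d(1))
  show ?thesis
    unfolding d(2) by (rule abs_eigenvalue_le) (use assms abs_adj_le_1 in auto)
qed

lemma mu_blow_up_close:
  assumes G: "G \<in> labelled_graphs" "gorder G = n" and H: "H \<in> labelled_graphs" "gorder H = N"
    and N: "0 < t" "N = n * t + s" "s < n" and i: "1 \<le> i" "i \<le> k" "k < n"
    and agree: "\<And>x y. x < n * t \<Longrightarrow> y < n * t \<Longrightarrow> x div t \<noteq> y div t \<Longrightarrow>
      adj H x y = adj G (x div t) (y div t)"
  defines "\<eta> \<equiv> 1 / sqrt (real (n - k)) + sqrt (1 / real n + 2 * real n / real N) + real n / real N"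
  shows "\<bar>mu i H / N - mu i G / n\<bar> \<le> \<eta>"
    and "\<bar>mu (N - i + 1) H / N - mu (n - i + 1) G / n\<bar> \<le> \<eta>"
proof -
  obtain d u where d: "eigensystem n (adj G) d u" "\<And>i. 1 \<le> i \<Longrightarrow> i \<le> n \<Longrightarrow> mu i G = d (i - 1)"
    using adjacency_eigensystem[OF G(1)] G(2) by metis
  obtain e w where e: "eigensystem N (adj H) e w" "\<And>i. 1 \<le> i \<Longrightarrow> i \<le> N \<Longrightarrow> mu i H = e (i - 1)"
    using adjacency_eigensystem[OF H(1)] H(2) by metis
  have "n * 1 \<le> n * t"
    using N(1) by (intro mult_le_mono2) simp
  then have iN: "i \<le> n" "i \<le> N"
    using N i by linarith+
  have ik: "i - 1 < k"
    using i by simp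
  have "\<bar>e (i - 1) / N - d (i - 1) / n\<bar> \<le> \<eta>"
    unfolding \<eta>_def
    by (rule blow_up_eigenvalue_close[OF d(1) e(1) N ik i(3)])
      (auto simp: abs_adj_le_1 adj_self[OF G(1)] intro: agree)
  then show "\<bar>mu i H / N - mu i G / n\<bar> \<le> \<eta>"
    using d(2) e(2) i iN by simp
  \<comment> \<open>Up to sign, the i-th smallest eigenvalue is entry \<open>i - 1\<close> of the
    negated system, so the bound for leading eigenvalues applies to it.\<close>
  have "\<bar>- e (N - 1 - (i - 1)) / N - - d (n - 1 - (i - 1)) / n\<bar> \<le> \<eta>"
    unfolding \<eta>_def
    by (rule blow_up_eigenvalue_close[OF eigensystem.negated[OF d(1)] eigensystem.negated[OF e(1)] N ik i(3)])
      (auto simp: abs_adj_le_1 adj_self[OF G(1)] intro: agree)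
  moreover have "N - i + 1 - 1 = N - 1 - (i - 1)" "n - i + 1 - 1 = n - 1 - (i - 1)"
    using i iN by auto
  ultimately show "\<bar>mu (N - i + 1) H / N - mu (n - i + 1) G / n\<bar> \<le> \<eta>"
    using d(2)[of "n - i + 1"] e(2)[of "N - i + 1"] i iN by (simp add: abs_minus_commute)
qed

lemma abs_weighted_sum_le:
  fixes \<alpha> \<beta> \<gamma> \<delta> a b c d :: "nat \<Rightarrow> real"
  assumes "\<And>i. i \<in> I \<Longrightarrow> \<bar>a i\<bar> \<le> \<eta> \<and> \<bar>b i\<bar> \<le> \<eta> \<and> \<bar>c i\<bar> \<le> \<eta> \<and> \<bar>d i\<bar> \<le> \<eta>"
  shows "\<bar>\<Sum>i\<in>I. \<alpha> i * a i + \<beta> i * b i + \<gamma> i * c i + \<delta> i * d i\<bar>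
    \<le> (\<Sum>i\<in>I. \<bar>\<alpha> i\<bar> + \<bar>\<beta> i\<bar> + \<bar>\<gamma> i\<bar> + \<bar>\<delta> i\<bar>) * \<eta>"
  unfolding sum_distrib_right
proof (rule order_trans[OF sum_abs sum_mono])
  fix i assume "i \<in> I"
  have le: "\<bar>p * x\<bar> \<le> \<bar>p\<bar> * \<eta>" if "\<bar>x\<bar> \<le> \<eta>" for p x :: real
    unfolding abs_mult using that by (intro mult_left_mono) auto
  note bounds = le[of "a i" "\<alpha> i"] le[of "b i" "\<beta> i"] le[of "c i" "\<gamma> i"] le[of "d i" "\<delta> i"]
  have "\<bar>\<alpha> i * a i + \<beta> i * b i + \<gamma> i * c i + \<delta> i * d i\<bar>
      \<le> \<bar>\<alpha> i * a i\<bar> + \<bar>\<beta> i * b i\<bar> + \<bar>\<gamma> i * c i\<bar> + \<bar>\<delta> i * d i\<bar>"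
    by (intro order_trans[OF abs_triangle_ineq] add_right_mono order_refl)
  also have "\<dots> \<le> \<bar>\<alpha> i\<bar> * \<eta> + \<bar>\<beta> i\<bar> * \<eta> + \<bar>\<gamma> i\<bar> * \<eta> + \<bar>\<delta> i\<bar> * \<eta>"
    using assms[OF \<open>i \<in> I\<close>] by (intro add_mono bounds) blast+
  finally show "\<bar>\<alpha> i * a i + \<beta> i * b i + \<gamma> i * c i + \<delta> i * d i\<bar>
      \<le> (\<bar>\<alpha> i\<bar> + \<bar>\<beta> i\<bar> + \<bar>\<gamma> i\<bar> + \<bar>\<delta> i\<bar>) * \<eta>"
    by (simp only: distrib_right)
qed

section \<open>Blow-ups as members of the property\<close>

text \<open>The vertex (u, i) of the blow-up receives the label (u - 1) t + i.\<close>

definition relabelled_blow_up :: "nat \<Rightarrow> nat pair_pre_digraph \<Rightarrow> nat pair_pre_digraph" where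
  "relabelled_blow_up t G =
    \<lparr>pverts = {1..gorder G * t},
     parcs = {(x, y). x \<in> {1..gorder G * t} \<and> y \<in> {1..gorder G * t} \<and>
       (Suc ((x - 1) div t), Suc ((y - 1) div t)) \<in> parcs G}\<rparr>"

lemma relabelled_blow_up_labelled:
  "G \<in> labelled_graphs \<Longrightarrow> relabelled_blow_up t G \<in> labelled_graphs"
  unfolding labelled_graphs_iff relabelled_blow_up_def by (auto simp: sym_def irrefl_def)

text \<open>The labelling \<open>f\<close> is inverted by \<open>g\<close>, which is division with
  remainder after a shift by 1. Arcs are pairs of vertices, so \<open>f\<close> also induces the map
  on arcs.\<close>

lemma digraph_iso_relabelled_blow_up:
  assumes "G \<in> labelled_graphs" "0 < t"
  shows "digraph_iso (with_proj (blow_up t G)) (with_proj (relabelled_blow_up t G))"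
proof -
  define n where "n = gorder G"
  define f where "f = (\<lambda>(u, i). (u - 1) * t + i :: nat)"
  define g where "g x = (Suc ((x - 1) div t), Suc ((x - 1) mod t))" for x
  have V: "pverts G = {1..n}" and E: "parcs G \<subseteq> {1..n} \<times> {1..n}"
    using assms(1) pverts_labelled[OF assms(1)] by (auto simp: labelled_graphs_iff n_def)
  have gf: "g (f (u, i)) = (u, i)" if u: "u \<in> {1..n}" and i: "i \<in> {1..t}" for u i
  proof -
    obtain i' where "i = Suc i'" "i' < t"
      using i by (cases i) auto
    with u show ?thesis
      by (simp add: f_def g_def)
  qed
  have fg: "f (g x) = x" if "1 \<le> x" for x
    using that div_mult_mod_eq[of "x - 1" t] by (simp add: f_def g_def)
  have f_mem: "f (u, i) \<in> {1..n * t}" if "u \<in> {1..n}" "i \<in> {1..t}" for u i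
  proof -
    have "(u - 1) * t + (i - 1) < n * t"
      using that by (intro block_index_less) auto
    then show ?thesis
      using that by (auto simp: f_def)
  qed
  have g_mem: "g x \<in> {1..n} \<times> {1..t}" if "x \<in> {1..n * t}" for x
  proof -
    have "(x - 1) div t < n" "(x - 1) mod t < t"
      using that assms(2) by (auto simp: less_mult_imp_div_less)
    then show ?thesis
      by (auto simp: g_def Suc_le_eq)
  qed
  define h where "h = \<lparr>iso_verts = f, iso_arcs = map_prod f f, iso_head = snd, iso_tail = fst\<rparr>"
  have verts_blow_up: "pverts (blow_up t G) = {1..n} \<times> {1..t}"
    by (simp add: blow_up_def V)
  have inj: "inj_on f ({1..n} \<times> {1..t})"
    by (rule inj_on_inverseI[where g = g]) (use gf in auto)
  have arcs: "parcs (blow_up t G) \<subseteq> ({1..n} \<times> {1..t}) \<times> ({1..n} \<times> {1..t})"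
    using E by (auto simp: blow_up_def)
  have "wf_digraph (with_proj (blow_up t G))"
    using E V by unfold_locales (auto simp: blow_up_def)
  then have "pre_digraph.digraph_isomorphism (with_proj (blow_up t G)) h"
    using inj inj_on_subset[OF map_prod_inj_on[OF inj inj] arcs]
    unfolding pre_digraph.digraph_isomorphism_def with_proj_simps h_def
    by (simp add: V verts_blow_up)
  moreover have "f ` ({1..n} \<times> {1..t}) = {1..n * t}"
  proof
    show "{1..n * t} \<subseteq> f ` ({1..n} \<times> {1..t})"
    proof
      fix x assume "x \<in> {1..n * t}"
      then show "x \<in> f ` ({1..n} \<times> {1..t})"
        using fg[of x] g_mem[of x] by (intro image_eqI[of _ _ "g x"]) auto
    qed
  qed (use f_mem in auto)
  moreover have "map_prod f f ` parcs (blow_up t G) = parcs (relabelled_blow_up t G)"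
  proof
    show "map_prod f f ` parcs (blow_up t G) \<subseteq> parcs (relabelled_blow_up t G)"
    proof
      fix p assume "p \<in> map_prod f f ` parcs (blow_up t G)"
      then obtain u i v j where p: "p = (f (u, i), f (v, j))" "(u, v) \<in> parcs G" "i \<in> {1..t}" "j \<in> {1..t}"
        by (auto simp: blow_up_def)
      then have "u \<in> {1..n}" "v \<in> {1..n}"
        using E by auto
      then show "p \<in> parcs (relabelled_blow_up t G)"
        using p f_mem[of u i] f_mem[of v j] gf[of u i] gf[of v j]
        by (auto simp: relabelled_blow_up_def g_def simp flip: n_def)
    qed
    show "parcs (relabelled_blow_up t G) \<subseteq> map_prod f f ` parcs (blow_up t G)"
    proof
      fix p assume "p \<in> parcs (relabelled_blow_up t G)"
      then obtain x y where p: "p = (x, y)" "x \<in> {1..n * t}" "y \<in> {1..n * t}"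
        "(fst (g x), fst (g y)) \<in> parcs G"
        by (auto simp: relabelled_blow_up_def g_def n_def)
      then show "p \<in> map_prod f f ` parcs (blow_up t G)"
        using fg[of x] fg[of y] g_mem[of x] g_mem[of y]
        by (intro image_eqI[of _ _ "(g x, g y)"]) (auto simp: blow_up_def mem_Times_iff case_prod_unfold)
    qed
  qed
  ultimately show ?thesis
    unfolding digraph_iso_def app_iso_def
    by (intro exI[of _ h]) (auto simp: h_def with_proj_def relabelled_blow_up_def blow_up_def V simp flip: n_def)
qed

definition padded_blow_up :: "nat \<Rightarrow> nat \<Rightarrow> nat pair_pre_digraph \<Rightarrow> nat pair_pre_digraph" where
  "padded_blow_up t s G = add_isolated s (relabelled_blow_up t G)"

lemma gorder_padded_blow_up: "gorder (padded_blow_up t s G) = gorder G * t + s"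
  by (simp add: padded_blow_up_def add_isolated_def relabelled_blow_up_def gorder_def)

lemma multiplicative_imp_labelled: "multiplicative \<F> \<Longrightarrow> G \<in> \<F> \<Longrightarrow> G \<in> labelled_graphs"
  unfolding multiplicative_def graph_property_def by blast

lemma padded_blow_up_mem:
  assumes "multiplicative \<F>" "G \<in> \<F>" "0 < t"
  shows "padded_blow_up t s G \<in> \<F>"
proof -
  have G: "G \<in> labelled_graphs"
    by (rule multiplicative_imp_labelled[OF assms(1,2)])
  have "\<forall>H \<in> labelled_graphs. digraph_iso (with_proj (blow_up t G)) (with_proj H) \<longrightarrow> H \<in> \<F>"
    using assms unfolding multiplicative_def by (simp add: Suc_le_eq)
  then have "relabelled_blow_up t G \<in> \<F>"
    using digraph_iso_relabelled_blow_up[OF G \<open>0 < t\<close>] relabelled_blow_up_labelled[OF G] by blast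
  then show ?thesis
    using assms(1) unfolding multiplicative_def padded_blow_up_def by blast
qed

lemma adj_padded_blow_up:
  assumes "x < gorder G * t" "y < gorder G * t"
  shows "adj (padded_blow_up t s G) x y = adj G (x div t) (y div t)"
  using assms by (simp add: adj_def padded_blow_up_def add_isolated_def relabelled_blow_up_def)

text \<open>The spectral sum is linear in the eigenvalues, and each normalised eigenvalue of the
  graph and of its complement moves by at most the same error.\<close>

lemma spectral_sum_padded_blow_up_close:
  assumes F: "multiplicative \<F>" "G \<in> \<F>" and n: "gorder G = n" "k < n"
    and N: "0 < t" "N = n * t + s" "s < n"
  shows "\<bar>spectral_sum k \<alpha> \<beta> \<gamma> \<delta> (padded_blow_up t s G) / N - spectral_sum k \<alpha> \<beta> \<gamma> \<delta> G / n\<bar>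
    \<le> (\<Sum>i = 1..k. \<bar>\<alpha> i\<bar> + \<bar>\<beta> i\<bar> + \<bar>\<gamma> i\<bar> + \<bar>\<delta> i\<bar>) *
      (1 / sqrt (real (n - k)) + sqrt (1 / real n + 2 * real n / real N) + real n / real N)"
    (is "_ \<le> _ * ?\<eta>")
proof -
  define H where "H = padded_blow_up t s G"
  have G: "G \<in> labelled_graphs"
    by (rule multiplicative_imp_labelled[OF F])
  have "H \<in> \<F>"
    using padded_blow_up_mem[OF F N(1)] by (simp add: H_def)
  then have H: "H \<in> labelled_graphs"
    by (rule multiplicative_imp_labelled[OF F(1)])
  have HN: "gorder H = N"
    by (simp add: H_def gorder_padded_blow_up n N)
  have adj: "adj H x y = adj G (x div t) (y div t)" if "x < n * t" "y < n * t" for x y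
    using that by (simp add: H_def adj_padded_blow_up n)
  \<comment> \<open>Agreement is restricted to distinct blocks: inside a block the complement of the
    blow-up is complete, while the blow-up of the complement has no edges there.\<close>
  have adj': "adj (graph_complement H) x y = adj (graph_complement G) (x div t) (y div t)"
    if "x < n * t" "y < n * t" "x div t \<noteq> y div t" for x y
  proof -
    have "x \<noteq> y" "x < N" "y < N" "x div t < n" "y div t < n"
      using that N by (auto simp: less_mult_imp_div_less)
    then show ?thesis
      using that by (simp add: adj_graph_complement G H HN n adj)
  qed
  note close = mu_blow_up_close[OF G n(1) H HN N _ _ n(2) adj]
  note co_close = mu_blow_up_close[OF graph_complement_labelled[OF G] _
      graph_complement_labelled[OF H] _ N _ _ n(2) adj']
  have *: "\<bar>mu i H / N - mu i G / n\<bar> \<le> ?\<eta> \<and>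
      \<bar>mu (N - i + 1) H / N - mu (n - i + 1) G / n\<bar> \<le> ?\<eta> \<and>
      \<bar>mu i (graph_complement H) / N - mu i (graph_complement G) / n\<bar> \<le> ?\<eta> \<and>
      \<bar>mu (N - i + 1) (graph_complement H) / N - mu (n - i + 1) (graph_complement G) / n\<bar> \<le> ?\<eta>"
    if "i \<in> {1..k}" for i
    by (intro conjI close co_close) (use that in \<open>simp_all add: n HN\<close>)
  have "spectral_sum k \<alpha> \<beta> \<gamma> \<delta> H / N - spectral_sum k \<alpha> \<beta> \<gamma> \<delta> G / n =
    (\<Sum>i = 1..k. \<alpha> i * (mu i H / N - mu i G / n)
      + \<beta> i * (mu (N - i + 1) H / N - mu (n - i + 1) G / n)
      + \<gamma> i * (mu i (graph_complement H) / N - mu i (graph_complement G) / n)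
      + \<delta> i * (mu (N - i + 1) (graph_complement H) / N - mu (n - i + 1) (graph_complement G) / n))"
    (is "_ = ?S")
    unfolding spectral_sum_def HN n(1) sum_divide_distrib sum_subtractf[symmetric]
    by (intro sum.cong refl) (simp add: add_divide_distrib algebra_simps)
  moreover have "\<bar>?S\<bar> \<le> (\<Sum>i = 1..k. \<bar>\<alpha> i\<bar> + \<bar>\<beta> i\<bar> + \<bar>\<gamma> i\<bar> + \<bar>\<delta> i\<bar>) * ?\<eta>"
    by (rule abs_weighted_sum_le) (rule *)
  ultimately show ?thesis
    by (simp only: H_def)
qed

lemma abs_spectral_sum_le:
  assumes "G \<in> labelled_graphs" "k \<le> gorder G"
  shows "\<bar>spectral_sum k \<alpha> \<beta> \<gamma> \<delta> G\<bar> \<le> (\<Sum>i = 1..k. \<bar>\<alpha> i\<bar> + \<bar>\<beta> i\<bar> + \<bar>\<gamma> i\<bar> + \<bar>\<delta> i\<bar>) * gorder G"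
  unfolding spectral_sum_def
proof (rule abs_weighted_sum_le)
  fix i assume "i \<in> {1..k}"
  then have "1 \<le> i" "i \<le> gorder G" "1 \<le> gorder G - i + 1" "gorder G - i + 1 \<le> gorder G"
    using assms(2) by auto
  then show "\<bar>mu i G\<bar> \<le> gorder G \<and> \<bar>mu (gorder G - i + 1) G\<bar> \<le> gorder G \<and>
      \<bar>mu i (graph_complement G)\<bar> \<le> gorder G \<and> \<bar>mu (gorder G - i + 1) (graph_complement G)\<bar> \<le> gorder G"
    using abs_mu_le[OF assms(1), of i] abs_mu_le[OF assms(1), of "gorder G - i + 1"]
      abs_mu_le[OF graph_complement_labelled[OF assms(1)], of i]
      abs_mu_le[OF graph_complement_labelled[OF assms(1)], of "gorder G - i + 1"]
    unfolding gorder_graph_complement by blast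
qed

section \<open>The limit of the normalised maxima\<close>

text \<open>The quantifiers are nested because \<open>N\<close> must be large compared with
  \<open>n\<close>: letting \<open>N\<close> grow first leaves only terms that vanish as
  \<open>n\<close> grows.\<close>

lemma blow_up_error_small:
  assumes "0 < \<epsilon>"
  shows "\<forall>\<^sub>F n in sequentially. \<forall>\<^sub>F N in sequentially.
    C * (1 / sqrt (real (n - k)) + sqrt (1 / real n + 2 * real n / real N) + real n / real N) < \<epsilon>"
proof -
  have sqrt0: "(\<lambda>n. sqrt (1 / real n)) \<longlonglongrightarrow> 0"
    using tendsto_real_sqrt[OF lim_const_over_n[of "1 :: real"]] by simp
  \<comment> \<open>Shifting by \<open>k\<close> removes the truncated subtraction.\<close>
  have "(\<lambda>n. 1 / sqrt (real (n + k - k))) \<longlonglongrightarrow> 0"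
    using sqrt0 by (simp add: real_sqrt_divide)
  then have "(\<lambda>n. 1 / sqrt (real (n - k))) \<longlonglongrightarrow> 0"
    by (rule LIMSEQ_offset)
  then have "(\<lambda>n. C * (1 / sqrt (real (n - k)) + sqrt (1 / real n))) \<longlonglongrightarrow> C * (0 + 0)"
    by (intro tendsto_intros sqrt0)
  then have "\<forall>\<^sub>F n in sequentially. C * (1 / sqrt (real (n - k)) + sqrt (1 / real n)) < \<epsilon>"
    by (rule order_tendstoD(2)) (use assms in simp)
  then show ?thesis
  proof eventually_elim
    case (elim n)
    have "(\<lambda>N. C * (1 / sqrt (real (n - k)) + sqrt (1 / real n + 2 * real n / real N) + real n / real N))
        \<longlonglongrightarrow> C * (1 / sqrt (real (n - k)) + sqrt (1 / real n + 0) + 0)"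
      by (intro tendsto_intros lim_const_over_n)
    then show ?case
      by (rule order_tendstoD(2)) (use elim in simp)
  qed
qed

theorem theorem1:
  fixes k :: nat and \<alpha> \<beta> \<gamma> \<delta> :: "nat \<Rightarrow> real" and \<F> :: "nat pair_pre_digraph set"
  assumes "k > 0"
    and "multiplicative \<F>"
    and "\<F> \<noteq> {}"
  shows "\<exists>c :: real.
    (\<lambda>n. Max {spectral_sum k \<alpha> \<beta> \<gamma> \<delta> G | G. G \<in> \<F> \<and> gorder G = n} / real n) \<longlonglongrightarrow> c \<and>
    ereal c = Limsup (gorder going_to at_top within \<F>)
      (\<lambda>G. ereal (spectral_sum k \<alpha> \<beta> \<gamma> \<delta> G / real (gorder G)))"
proof -
  define C where "C = (\<Sum>i = 1..k. \<bar>\<alpha> i\<bar> + \<bar>\<beta> i\<bar> + \<bar>\<gamma> i\<bar> + \<bar>\<delta> i\<bar>)"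
  define f where "f G = spectral_sum k \<alpha> \<beta> \<gamma> \<delta> G / real (gorder G)" for G
  define A where "A n = {spectral_sum k \<alpha> \<beta> \<gamma> \<delta> G | G. G \<in> \<F> \<and> gorder G = n}" for n
  define \<Phi> where "\<Phi> = gorder going_to at_top within \<F>"
  have ev: "eventually P \<Phi> \<longleftrightarrow> (\<exists>m. \<forall>G\<in>\<F>. m \<le> gorder G \<longrightarrow> P G)" for P
    by (simp add: \<Phi>_def eventually_going_to_at_top_linorder)
  have f_bound: "\<bar>f G\<bar> \<le> C" if "G \<in> \<F>" "k \<le> gorder G" for G
    using abs_spectral_sum_le[OF multiplicative_imp_labelled[OF assms(2) that(1)] that(2), of \<alpha> \<beta> \<gamma> \<delta>]
      that(2) assms(1) by (simp add: f_def C_def abs_divide pos_divide_le_eq)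
  have A_image: "A n = spectral_sum k \<alpha> \<beta> \<gamma> \<delta> ` {G \<in> \<F>. gorder G = n}" for n
    by (auto simp: A_def)
  have A: "\<forall>\<^sub>F n in sequentially. finite (A n) \<and> A n \<noteq> {}"
    using eventually_members_of_order[OF assms(2,3)] unfolding A_image
    by eventually_elim simp
  \<comment> \<open>On the trivial filter the upper limit would be minus infinity. Members of all
    large orders exist, since isolated vertices can be added.\<close>
  have "\<Phi> \<noteq> bot"
  proof
    assume "\<Phi> = bot"
    then have "eventually (\<lambda>_. False) \<Phi>"
      by simp
    then obtain m where m: "\<And>G. G \<in> \<F> \<Longrightarrow> \<not> m \<le> gorder G"
      unfolding ev by blast
    have "\<forall>\<^sub>F n in sequentially. m \<le> n \<and> A n \<noteq> {}"
      using A eventually_ge_at_top[of m] by eventually_elim simp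
    then obtain n where "m \<le> n" "A n \<noteq> {}"
      unfolding eventually_sequentially by blast
    then show False
      using m unfolding A_def by blast
  qed
  define L where "L = Limsup \<Phi> (\<lambda>G. ereal (f G))"
  have f_ev: "\<forall>\<^sub>F G in \<Phi>. \<bar>f G\<bar> \<le> C"
    unfolding ev using f_bound by blast
  \<comment> \<open>Normalised values lie between - C and C, which makes the upper limit a real
    number.\<close>
  have "L \<le> ereal C"
    unfolding L_def by (rule Limsup_bounded) (use f_ev in eventually_elim, simp)
  moreover have "ereal (- C) \<le> L"
    unfolding L_def by (rule le_Limsup[OF \<open>\<Phi> \<noteq> bot\<close>]) (use f_ev in eventually_elim, simp)
  ultimately obtain c where c: "L = ereal c"
    by (cases L) auto
  have "(\<lambda>n. Max (A n) / real n) \<longlonglongrightarrow> c"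
  proof (rule order_tendstoI)
    fix b assume "c < b"
    then have "L < ereal b"
      by (simp add: c)
    then have "\<forall>\<^sub>F G in \<Phi>. ereal (f G) < ereal b"
      unfolding L_def by (rule Limsup_lessD)
    then obtain m where m: "\<And>G. G \<in> \<F> \<Longrightarrow> m \<le> gorder G \<Longrightarrow> f G < b"
      unfolding ev by auto
    show "\<forall>\<^sub>F n in sequentially. Max (A n) / real n < b"
      using A eventually_ge_at_top[of m]
    proof eventually_elim
      case (elim n)
      then have "Max (A n) \<in> A n"
        by (intro Max_in) auto
      then obtain G where "G \<in> \<F>" "gorder G = n" "Max (A n) = spectral_sum k \<alpha> \<beta> \<gamma> \<delta> G"
        unfolding A_def by blast
      then show ?case
        using m[of G] elim by (simp add: f_def)
    qed
  next
    fix b assume "b < c"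
    \<comment> \<open>Half of the gap pays for the choice of \<open>G\<close> below the upper limit,
      the other half for the passage from \<open>G\<close> to its blow-up.\<close>
    define \<epsilon> where "\<epsilon> = (c - b) / 2"
    have \<epsilon>: "0 < \<epsilon>" "c - \<epsilon> = b + \<epsilon>"
      using \<open>b < c\<close> by (auto simp: \<epsilon>_def field_simps)
    have "\<forall>\<^sub>F n in sequentially. k < n \<and> (\<forall>\<^sub>F N in sequentially.
        C * (1 / sqrt (real (n - k)) + sqrt (1 / real n + 2 * real n / real N) + real n / real N) < \<epsilon>)"
      using blow_up_error_small[OF \<epsilon>(1), of C k] eventually_gt_at_top[of k] by eventually_elim blast
    then obtain m where m: "\<And>n. m \<le> n \<Longrightarrow> k < n" "\<And>n. m \<le> n \<Longrightarrow> \<forall>\<^sub>F N in sequentially.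
        C * (1 / sqrt (real (n - k)) + sqrt (1 / real n + 2 * real n / real N) + real n / real N) < \<epsilon>"
      unfolding eventually_sequentially by blast
    \<comment> \<open>By definition of the upper limit, values above c - \<epsilon> occur at
      arbitrarily large orders; in particular at some order from \<open>m\<close> on, where the
      error is under control.\<close>
    have "\<not> (\<forall>\<^sub>F G in \<Phi>. ereal (f G) \<le> ereal (c - \<epsilon>))"
    proof
      assume "\<forall>\<^sub>F G in \<Phi>. ereal (f G) \<le> ereal (c - \<epsilon>)"
      then have "L \<le> ereal (c - \<epsilon>)"
        unfolding L_def by (rule Limsup_bounded)
      with \<epsilon>(1) show False
        by (simp add: c)
    qed
    then obtain G where G: "G \<in> \<F>" "m \<le> gorder G" "c - \<epsilon> < f G"
      unfolding ev by (auto simp: not_le)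
    define n where "n = gorder G"
    have "k < n"
      using m(1) G(2) by (simp add: n_def)
    show "\<forall>\<^sub>F N in sequentially. b < Max (A N) / real N"
      using A m(2)[OF G(2), folded n_def] eventually_ge_at_top[of n]
    proof eventually_elim
      case (elim N)
      \<comment> \<open>Division with remainder gives \<open>H\<close> order exactly
        \<open>N\<close>; the quotient is positive because N \<ge> n.\<close>
      define H where "H = padded_blow_up (N div n) (N mod n) G"
      have N: "0 < N div n" "N = n * (N div n) + N mod n" "N mod n < n"
        using elim(3) \<open>k < n\<close> by (auto simp: div_greater_zero_iff)
      have "H \<in> \<F>"
        unfolding H_def by (rule padded_blow_up_mem[OF assms(2) G(1) N(1)])
      moreover have HN: "gorder H = N"
        using N(2) by (simp add: H_def gorder_padded_blow_up flip: n_def)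
      ultimately have "spectral_sum k \<alpha> \<beta> \<gamma> \<delta> H \<in> A N"
        unfolding A_def by blast
      then have "spectral_sum k \<alpha> \<beta> \<gamma> \<delta> H \<le> Max (A N)"
        using elim(1) by (intro Max_ge) auto
      then have "f H \<le> Max (A N) / real N"
        by (simp add: f_def HN divide_right_mono)
      moreover have "\<bar>f H - f G\<bar> < \<epsilon>"
        using spectral_sum_padded_blow_up_close[OF assms(2) G(1) n_def[symmetric] \<open>k < n\<close> N,
            of \<alpha> \<beta> \<gamma> \<delta>, folded H_def C_def] elim(2)
        unfolding f_def HN n_def[symmetric] by (rule le_less_trans)
      ultimately show ?case
        using G(3) \<epsilon>(2) by linarith
    qed
  qed
  then show ?thesis
    using c unfolding A_def L_def \<Phi>_def f_def by (intro exI[of _ c] conjI) (simp_all only:)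
qed

end
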